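(* Let $I,\overline J,\mathsf h$ be as in the context, and let $\overline J'=\{\overline j\in\overline J:\ \exists\, i_1,i_2\in I\text{ with } i_1\prec i_2\prec\overline j\}$. Then the support (union of all cells) of $\mathrm{Asso}_{I,\overline J}(\mathsf h)$ is convex if and only if the ordered set $(I\sqcup\overline J')\setminus\{\max\overline J\}$ contains no pair of consecutive elements that both belong to $\overline J$. In this case, $\mathrm{Asso}_{I,\overline J}(\mathsf h)$ is a regular polyhedral subdivision of a (polytope combinatorially equivalent to a) classical associahedron of dimension $|\overline J'|-1$.
   Context: $\mathbb{N}=\{0,1,\dots\}$, $\overline{\mathbb{N}}$ a disjoint copy, totally ordered by $i\prec\overline i\prec i+1$. $I\subset\mathbb{N}$, $\overline J\subset\overline{\mathbb{N}}$ are nonempty finite with $\min(I\sqcup\overline J)\in I$ and $\overline j_{\max}:=\max(I\sqcup\overline J)\in\overline J$. $\mathsf h$ is a real function on $\{(i,\overline j)\in I\times\overline J: i\le j\}$ with $\mathsf h(i,\overline{j'})+\mathsf h(i',\overline j)<\mathsf h(i,\overline j)+\mathsf h(i',\overline{j'})$ whenever $i<i'\le j<j'$, extended by $\mathsf h(i,\overline j)=+\infty$ for $j<i$. For $i\in I$, $H_i=\{x\in\mathbb{R}^{\overline J}: \max_{\overline j\in\overline J}(x_{\overline j}-\mathsf h(i,\overline j))\text{ attained at least twice}\}$. The arrangement $(H_i)_{i\in I}$ subdivides $\{x\in\mathbb{R}^{\overline J}:x_{\overline j_{\max}}=0\}\cong\mathbb{R}^{\overline J\setminus\{\overline j_{\max}\}}$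 into closed cells (closures of the sets of points having the same set of maximizing indices for every $i$); $\mathrm{Asso}_{I,\overline J}(\mathsf h)$ is the polyhedral complex of its bounded cells.
   Formalization: When I has a single element, J' is empty and Asso is one point, so the stated dimension |J'|-1 = -1 is false; the formal statement uses dimension 0 in that case and |J'|-1 in all others. *)

theory Defs
  imports "HOL-Analysis.Analysis" "HOL-Library.Extended_Real"
begin

text \<open>The disjoint union of the naturals and the barred naturals is \<^typ>\<open>nat + nat\<close>:
  \<open>Inl i\<close> is \<open>i\<close> and \<open>Inr j\<close> is \<open>j\<close> with a bar. The positions \<open>2 * i\<close> and \<open>2 * j + 1\<close>
  realise the order in which \<open>Inl i\<close>, \<open>Inr i\<close>, \<open>Inl (i + 1)\<close> are successive.\<close>

fun pos :: "nat + nat \<Rightarrow> nat" where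
  "pos (Inl i) = 2 * i"
| "pos (Inr j) = 2 * j + 1"

definition prec :: "nat + nat \<Rightarrow> nat + nat \<Rightarrow> bool" (infix "\<prec>" 50) where
  "a \<prec> b \<longleftrightarrow> pos a < pos b"

definition preceq :: "nat + nat \<Rightarrow> nat + nat \<Rightarrow> bool" (infix "\<preceq>" 50) where
  "a \<preceq> b \<longleftrightarrow> a \<prec> b \<or> a = b"

lemma prec_simps [simp]:
  "Inl i \<prec> Inl i' \<longleftrightarrow> i < i'" "Inr j \<prec> Inr j' \<longleftrightarrow> j < j'"
  "Inl i \<prec> Inr j \<longleftrightarrow> i \<le> j" "Inr j \<prec> Inl i \<longleftrightarrow> j < i"
  by (auto simp: prec_def)

definition consecutive_in :: "(nat + nat) set \<Rightarrow> nat + nat \<Rightarrow> nat + nat \<Rightarrow> bool" where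
  "consecutive_in S a b \<longleftrightarrow> a \<in> S \<and> b \<in> S \<and> a \<prec> b \<and> \<not> (\<exists>c\<in>S. a \<prec> c \<and> c \<prec> b)"

definition J_prime :: "nat set \<Rightarrow> nat set \<Rightarrow> nat set" where
  "J_prime I J = {j \<in> J. \<exists>i1\<in>I. \<exists>i2\<in>I. Inl i1 \<prec> Inl i2 \<and> Inl i2 \<prec> Inr j}"

text \<open>Throughout, \<open>idx\<close> is a bijection from a finite type \<^typ>\<open>'n\<close> onto the index set \<open>J\<close>,
  so that \<^typ>\<open>real ^ 'n\<close> is the space of real vectors indexed by \<open>J\<close>. The values \<open>h i j\<close>
  with \<open>j < i\<close> are never used.\<close>

definition h_ext :: "(nat \<Rightarrow> nat \<Rightarrow> real) \<Rightarrow> nat \<Rightarrow> nat \<Rightarrow> ereal" where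
  "h_ext h i j = (if i \<le> j then ereal (h i j) else \<infinity>)"

text \<open>The tropical hyperplane \<open>H_i\<close> is the set of points \<open>x\<close> at which \<open>maximizers idx h i x\<close>
  has at least two elements.\<close>

definition maximizers ::
  "('n::finite \<Rightarrow> nat) \<Rightarrow> (nat \<Rightarrow> nat \<Rightarrow> real) \<Rightarrow> nat \<Rightarrow> real ^ 'n \<Rightarrow> 'n set" where
  "maximizers idx h i x =
     {j. \<forall>k. ereal (x $ k) - h_ext h i (idx k) \<le> ereal (x $ j) - h_ext h i (idx j)}"

definition tropical_hyperplane ::
  "('n::finite \<Rightarrow> nat) \<Rightarrow> (nat \<Rightarrow> nat \<Rightarrow> real) \<Rightarrow> nat \<Rightarrow> (real ^ 'n) set" where
  "tropical_hyperplane idx h i = {x. card (maximizers idx h i x) \<ge> 2}"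

definition slice :: "('n::finite \<Rightarrow> nat) \<Rightarrow> (real ^ 'n) set" where
  "slice idx = {x. \<forall>j. idx j = Max (range idx) \<longrightarrow> x $ j = 0}"

definition arrangement_cells ::
  "nat set \<Rightarrow> ('n::finite \<Rightarrow> nat) \<Rightarrow> (nat \<Rightarrow> nat \<Rightarrow> real) \<Rightarrow> (real ^ 'n) set set" where
  "arrangement_cells I idx h =
     (\<lambda>x. closure {y \<in> slice idx. \<forall>i\<in>I. maximizers idx h i y = maximizers idx h i x}) ` slice idx"

definition Asso ::
  "nat set \<Rightarrow> ('n::finite \<Rightarrow> nat) \<Rightarrow> (nat \<Rightarrow> nat \<Rightarrow> real) \<Rightarrow> (real ^ 'n) set set" where
  "Asso I idx h = {C \<in> arrangement_cells I idx h. bounded C}"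

text \<open>The empty cell is left out of complexes; since the empty set is a face of every convex set,
  the intersection condition allows disjoint cells.\<close>

definition polytopal_complex :: "'a::euclidean_space set set \<Rightarrow> bool" where
  "polytopal_complex \<C> \<longleftrightarrow>
     finite \<C> \<and>
     (\<forall>C\<in>\<C>. polytope C \<and> C \<noteq> {}) \<and>
     (\<forall>C\<in>\<C>. \<forall>F. F face_of C \<and> F \<noteq> {} \<longrightarrow> F \<in> \<C>) \<and>
     (\<forall>C\<in>\<C>. \<forall>D\<in>\<C>. C \<inter> D face_of C \<and> C \<inter> D face_of D)"

definition polyhedral_subdivision :: "'a::euclidean_space set set \<Rightarrow> 'a set \<Rightarrow> bool" where
  "polyhedral_subdivision \<C> P \<longleftrightarrow> polytope P \<and> polytopal_complex \<C> \<and> \<Union>\<C> = P"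

text \<open>The nonempty lower faces: those minimising a linear functional whose coefficient on the
  height coordinate is positive (normalised to 1).\<close>

definition lower_faces :: "('a::euclidean_space \<times> real) set \<Rightarrow> ('a \<times> real) set set" where
  "lower_faces Q = {F. F \<noteq> {} \<and> (\<exists>c. F = {z \<in> Q. \<forall>w\<in>Q. c \<bullet> fst z + snd z \<le> c \<bullet> fst w + snd w})}"

definition regular_subdivision :: "'a::euclidean_space set set \<Rightarrow> 'a set \<Rightarrow> bool" where
  "regular_subdivision \<C> P \<longleftrightarrow>
     polyhedral_subdivision \<C> P \<and>
     (\<exists>Q. polytope Q \<and> fst ` Q = P \<and> \<C> = (\<lambda>F. fst ` F) ` lower_faces Q)"

text \<open>Diagonals of the convex polygon with vertices \<open>0, \<dots>, n - 1\<close> in cyclic order.\<close>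

definition diagonals :: "nat \<Rightarrow> (nat \<times> nat) set" where
  "diagonals n = {(a, b). a + 1 < b \<and> b < n \<and> \<not> (a = 0 \<and> b = n - 1)}"

definition crossing :: "nat \<times> nat \<Rightarrow> nat \<times> nat \<Rightarrow> bool" where
  "crossing p q \<longleftrightarrow>
     fst p < fst q \<and> fst q < snd p \<and> snd p < snd q \<or>
     fst q < fst p \<and> fst p < snd q \<and> snd q < snd p"

definition dissections :: "nat \<Rightarrow> (nat \<times> nat) set set" where
  "dissections n = {D. D \<subseteq> diagonals n \<and> (\<forall>p\<in>D. \<forall>q\<in>D. \<not> crossing p q)}"

text \<open>A polytope of the combinatorial type of the classical \<open>d\<close>-dimensional associahedron: its
  nonempty faces, ordered by inclusion, correspond to the sets of pairwise noncrossing diagonals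
  of a \<open>(d + 3)\<close>-gon, ordered by reverse inclusion.\<close>

definition combinatorial_associahedron :: "nat \<Rightarrow> 'a::euclidean_space set \<Rightarrow> bool" where
  "combinatorial_associahedron d P \<longleftrightarrow>
     polytope P \<and> aff_dim P = int d \<and>
     (\<exists>\<phi>. bij_betw \<phi> {F. F face_of P \<and> F \<noteq> {}} (dissections (d + 3)) \<and>
          (\<forall>F G. F face_of P \<and> F \<noteq> {} \<and> G face_of P \<and> G \<noteq> {} \<longrightarrow>
                 (F \<subseteq> G \<longleftrightarrow> \<phi> G \<subseteq> \<phi> F)))"

end

theory Submission
  imports Defs
begin

text \<open>A point \<open>x\<close> is recorded by the bipartite graph joining \<open>i\<close> to the maximizing indices of \<open>H_i\<close> at
  \<open>x\<close>; the Monge inequality makes this graph noncrossing. The cell of \<open>x\<close> is bounded exactly when the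
  graph covers \<open>J\<close> and contains the arc from \<open>min I\<close> to \<open>max J\<close>.

  Normalise so that \<open>h (min I) = 0\<close>. If no two elements of \<open>J'\<close> below \<open>max J\<close> are consecutive, then
  each \<open>j\<close> only needs the covering condition at \<open>a j\<close>, the largest element of \<open>I\<close> below \<open>j\<close>, so the
  support is the polytope \<open>x j \<le> 0\<close>, \<open>x k - x j \<le> h (a j) k - h (a j) j\<close> (\<open>j < k\<close>). Its
  constraints correspond to the diagonals of a polygon; crossing diagonals are never tight
  simultaneously, again by the Monge inequality, and every noncrossing set is the tight set of some
  point, by induction along a splitting diagonal. The subdivision is regular because it consists of
  the linearity domains of the convex function \<open>x \<mapsto> (\<Sum>i. max_j (x j - h i j))\<close>. If two elements of
  \<open>J'\<close> are consecutive, a path in the support involving only the last two elements of \<open>I\<close> below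
  them has a kink, and the midpoint of its ends lies outside the support.\<close>

section \<open>Constraint sets and epigraphs\<close>

definition affine_map :: "('a::euclidean_space \<Rightarrow> real) \<Rightarrow> bool" where
  "affine_map g \<longleftrightarrow> (\<exists>v c. \<forall>x. g x = v \<bullet> x + c)"

lemma affine_mapD: "affine_map g \<Longrightarrow> g ((1 - t) *\<^sub>R x + t *\<^sub>R y) = (1 - t) * g x + t * g y"
  unfolding affine_map_def by (auto simp: inner_add_right algebra_simps)

lemma affine_map_const: "affine_map (\<lambda>x. c)"
  unfolding affine_map_def by (intro exI[of _ 0] exI[of _ c]) simp

lemma affine_map_component: "affine_map (\<lambda>x::real^'n. x $ n)"
  unfolding affine_map_def by (intro exI[of _ "axis n 1"] exI[of _ 0]) (simp add: inner_axis')

lemma affine_map_add: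
  assumes "affine_map f" "affine_map g"
  shows "affine_map (\<lambda>x. f x + g x)"
proof -
  obtain v c w d where "\<And>x. f x = v \<bullet> x + c" "\<And>x. g x = w \<bullet> x + d"
    using assms unfolding affine_map_def by auto
  then have "f x + g x = (v + w) \<bullet> x + (c + d)" for x by (simp add: inner_add_left)
  then show ?thesis unfolding affine_map_def by blast
qed

lemma affine_map_diff:
  assumes "affine_map f" "affine_map g"
  shows "affine_map (\<lambda>x. f x - g x)"
proof -
  obtain v c w d where "\<And>x. f x = v \<bullet> x + c" "\<And>x. g x = w \<bullet> x + d"
    using assms unfolding affine_map_def by auto
  then have "f x - g x = (v - w) \<bullet> x + (c - d)" for x by (simp add: inner_diff_left)
  then show ?thesis unfolding affine_map_def by blast
qed

lemmas affine_map_intros = affine_map_const affine_map_component affine_map_add affine_map_diff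

lemma polyhedron_affine_map_le:
  assumes "affine_map g"
  shows "polyhedron {x. g x \<le> 0}"
proof -
  obtain v c where "\<And>x. g x = v \<bullet> x + c" using assms unfolding affine_map_def by auto
  then have "{x. g x \<le> 0} = {x. v \<bullet> x \<le> - c}" by auto
  then show ?thesis using polyhedron_halfspace_le by simp
qed

lemma open_affine_map_less:
  assumes "affine_map g"
  shows "open {x. g x < 0}"
proof -
  obtain v c where "\<And>x. g x = v \<bullet> x + c" using assms unfolding affine_map_def by auto
  then have "{x. g x < 0} = {x. v \<bullet> x < - c}" by auto
  then show ?thesis using open_halfspace_lt by simp
qed

section \<open>Faces read off from tight constraints\<close>

definition tight :: "('k \<Rightarrow> 'a \<Rightarrow> real) \<Rightarrow> 'k set \<Rightarrow> 'a \<Rightarrow> 'k set" where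
  "tight g K x = {k \<in> K. g k x = 0}"

text \<open>Constraints slack at \<open>x\<close> leave room there, and those tight at
  \<open>x\<close> vanish along the whole line, so the segment from \<open>y\<close> continues a
  little beyond \<open>x\<close>. For \<open>y\<close> in the polyhedron, this expresses that
  \<open>x\<close> is relatively interior to the face cut out by its own tight constraints.\<close>

lemma prolong_segment:
  fixes g :: "'k \<Rightarrow> 'a::euclidean_space \<Rightarrow> real"
  assumes "finite K" and g: "\<And>k. k \<in> K \<Longrightarrow> affine_map (g k)"
    and x: "\<And>k. k \<in> K \<Longrightarrow> g k x \<le> 0" and xy: "tight g K x \<subseteq> tight g K y"
  shows "\<exists>e>1. \<forall>k\<in>K. g k ((1 - e) *\<^sub>R y + e *\<^sub>R x) \<le> 0"
proof -
  have "\<forall>\<^sub>F e in at_right 1. g k ((1 - e) *\<^sub>R y + e *\<^sub>R x) \<le> 0" if k: "k \<in> K" for k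
  proof (cases "g k x = 0")
    case True
    then have "g k y = 0" using xy k unfolding tight_def by auto
    then show ?thesis using True affine_mapD[OF g[OF k]] by simp
  next
    case False
    then have "g k x < 0" using x[OF k] by auto
    have "((\<lambda>e. (1 - e) * g k y + e * g k x) \<longlongrightarrow> (1 - 1) * g k y + 1 * g k x) (at_right 1)"
      by (intro tendsto_intros)
    then have "\<forall>\<^sub>F e in at_right 1. (1 - e) * g k y + e * g k x < 0"
      by (rule order_tendstoD) (use \<open>g k x < 0\<close> in simp)
    then show ?thesis by eventually_elim (simp add: affine_mapD[OF g[OF k]])
  qed
  then have "\<forall>\<^sub>F e in at_right 1. \<forall>k\<in>K. g k ((1 - e) *\<^sub>R y + e *\<^sub>R x) \<le> 0"
    using \<open>finite K\<close> by (simp add: eventually_ball_finite)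
  moreover have "\<forall>\<^sub>F e in at_right 1. (1::real) < e" by (simp add: eventually_at_right_less)
  ultimately have "\<forall>\<^sub>F e in at_right 1. 1 < e \<and> (\<forall>k\<in>K. g k ((1 - e) *\<^sub>R y + e *\<^sub>R x) \<le> 0)"
    by eventually_elim auto
  then show ?thesis
    using eventually_happens' trivial_limit_at_right_real by blast
qed

lemma prolonged_in_open_segment:
  fixes x y :: "'a::real_vector"
  assumes "e > 1" "x \<noteq> y"
  shows "x \<in> open_segment y ((1 - e) *\<^sub>R y + e *\<^sub>R x)"
proof -
  have "x = (1 - 1 / e) *\<^sub>R y + (1 / e) *\<^sub>R ((1 - e) *\<^sub>R y + e *\<^sub>R x)"
    using assms by (simp add: algebra_simps)
  moreover have "(1 - e) *\<^sub>R y + e *\<^sub>R x \<noteq> y"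
  proof
    assume "(1 - e) *\<^sub>R y + e *\<^sub>R x = y"
    then have "e *\<^sub>R (x - y) = 0" by (simp add: algebra_simps)
    then show False using assms by auto
  qed
  ultimately show ?thesis using assms unfolding in_segment
    by (metis divide_less_eq_1_pos less_trans zero_less_divide_1_iff zero_less_one)
qed

text \<open>A relatively interior point \<open>x\<close> of a face represents it: prolonging
  segments of the face beyond \<open>x\<close> makes the constraints tight at \<open>x\<close> tight
  on the whole face, and \<open>prolong_segment\<close> pulls every point with these constraints
  tight into the face. Conversely, a nonpositive affine function that vanishes inside a segment
  vanishes at both ends.\<close>

lemma face_of_constraint_set:
  fixes g :: "'k \<Rightarrow> 'a::euclidean_space \<Rightarrow> real"
  assumes A: "affine A" and "finite K" and g: "\<And>k. k \<in> K \<Longrightarrow> affine_map (g k)"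
    and P: "P = {x \<in> A. \<forall>k\<in>K. g k x \<le> 0}"
  shows "F face_of P \<and> F \<noteq> {} \<longleftrightarrow> (\<exists>x\<in>P. F = {y \<in> P. tight g K x \<subseteq> tight g K y})"
    (is "?L \<longleftrightarrow> ?R")
proof
  assume F: ?L
  then have "convex F" "F \<subseteq> P" using face_of_imp_convex face_of_imp_subset by blast+
  then obtain x where x: "x \<in> rel_interior F" using F rel_interior_eq_empty by blast
  then have xF: "x \<in> F" using rel_interior_subset by blast
  have "F = {y \<in> P. tight g K x \<subseteq> tight g K y}"
  proof (intro equalityI subsetI)
    fix y assume y: "y \<in> F"
    then obtain e where e: "e > 1" "(1 - e) *\<^sub>R y + e *\<^sub>R x \<in> F"
      using x convex_rel_interior_iff[of F] \<open>convex F\<close> F by blast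
    have "k \<in> tight g K y" if k: "k \<in> tight g K x" for k
    proof -
      have kK: "k \<in> K" "g k x = 0" using k unfolding tight_def by auto
      then have "g k ((1 - e) *\<^sub>R y + e *\<^sub>R x) \<le> 0" "g k y \<le> 0"
        using e y \<open>F \<subseteq> P\<close> P by auto
      then have "(1 - e) * g k y \<le> 0" using affine_mapD[OF g[OF kK(1)]] kK by auto
      then have "g k y \<ge> 0" using e(1) by (auto simp: mult_le_0_iff)
      then show ?thesis using \<open>g k y \<le> 0\<close> kK unfolding tight_def by auto
    qed
    then show "y \<in> {y \<in> P. tight g K x \<subseteq> tight g K y}" using y \<open>F \<subseteq> P\<close> by auto
  next
    fix y assume "y \<in> {y \<in> P. tight g K x \<subseteq> tight g K y}"
    then have y: "y \<in> P" "tight g K x \<subseteq> tight g K y" by auto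
    have xP: "x \<in> P" using xF \<open>F \<subseteq> P\<close> by auto
    have "\<exists>e>1. \<forall>k\<in>K. g k ((1 - e) *\<^sub>R y + e *\<^sub>R x) \<le> 0"
      using assms xP y by (intro prolong_segment) auto
    then obtain e where e: "e > 1" "\<forall>k\<in>K. g k ((1 - e) *\<^sub>R y + e *\<^sub>R x) \<le> 0" by auto
    moreover have "(1 - e) *\<^sub>R y + e *\<^sub>R x \<in> A"
      using A y(1) xP unfolding P by (intro mem_affine) auto
    ultimately have "(1 - e) *\<^sub>R y + e *\<^sub>R x \<in> P" unfolding P by auto
    then show "y \<in> F"
      using F prolonged_in_open_segment[OF e(1), of x y] y(1) xF unfolding face_of_def by blast
  qed
  then show ?R using xF \<open>F \<subseteq> P\<close> by auto
next
  assume ?R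
  then obtain x where x: "x \<in> P" and F: "F = {y \<in> P. tight g K x \<subseteq> tight g K y}" by auto
  have conv: "convex F"
    unfolding convex_alt
  proof (intro ballI allI impI)
    fix y z and u :: real assume *: "y \<in> F" "z \<in> F" "0 \<le> u \<and> u \<le> 1"
    have "(1 - u) *\<^sub>R y + u *\<^sub>R z \<in> A" using A * unfolding F P by (intro mem_affine) auto
    moreover have "g k ((1 - u) *\<^sub>R y + u *\<^sub>R z) \<le> 0" if "k \<in> K" for k
    proof -
      have "g k y \<le> 0" "g k z \<le> 0" using that * unfolding F P by auto
      then show ?thesis unfolding affine_mapD[OF g[OF that]] using *
        by (meson add_nonpos_nonpos diff_ge_0_iff_ge mult_nonneg_nonpos)
    qed
    moreover have "g k ((1 - u) *\<^sub>R y + u *\<^sub>R z) = 0" if "k \<in> tight g K x" for k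
    proof -
      have "k \<in> K" "g k y = 0" "g k z = 0" using * that unfolding F tight_def by auto
      then show ?thesis using affine_mapD[OF g] by simp
    qed
    ultimately show "(1 - u) *\<^sub>R y + u *\<^sub>R z \<in> F"
      unfolding F P tight_def by auto
  qed
  have "y \<in> F \<and> z \<in> F" if yz: "y \<in> P" "z \<in> P" and w: "w \<in> F" "w \<in> open_segment y z" for y z w
  proof -
    obtain u where u: "0 < u" "u < 1" "w = (1 - u) *\<^sub>R y + u *\<^sub>R z"
      using w(2) unfolding in_segment by auto
    have "g k y = 0 \<and> g k z = 0" if k: "k \<in> tight g K x" for k
    proof -
      have kK: "k \<in> K" "g k w = 0" using k w(1) unfolding F tight_def by auto
      then have "(1 - u) * g k y + u * g k z = 0" "g k y \<le> 0" "g k z \<le> 0"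
        using u(3) affine_mapD[OF g[OF kK(1)]] yz P by auto
      moreover from this have "(1 - u) * g k y \<le> 0" "u * g k z \<le> 0"
        using u by (auto simp: mult_le_0_iff)
      ultimately have "(1 - u) * g k y = 0" "u * g k z = 0" by linarith+
      then show ?thesis using u by auto
    qed
    then show ?thesis using yz unfolding F tight_def by auto
  qed
  then have "F face_of P" using conv unfolding face_of_def F by blast
  moreover have "F \<noteq> {}" using x F by auto
  ultimately show ?L by auto
qed

text \<open>Passing from a face to the constraints tight on all of it reverses inclusion, so the
  face lattice is known once the tight sets realised by points of \<open>P\<close> are
  known.\<close>

lemma face_lattice_of_constraint_set:
  fixes g :: "'k \<Rightarrow> 'a::euclidean_space \<Rightarrow> real"
  assumes "affine A" and "finite K" and "\<And>k. k \<in> K \<Longrightarrow> affine_map (g k)"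
    and P: "P = {x \<in> A. \<forall>k\<in>K. g k x \<le> 0}"
  shows "\<exists>\<phi>. bij_betw \<phi> {F. F face_of P \<and> F \<noteq> {}} (tight g K ` P) \<and>
          (\<forall>F G. F face_of P \<and> F \<noteq> {} \<and> G face_of P \<and> G \<noteq> {} \<longrightarrow>
                 (F \<subseteq> G \<longleftrightarrow> \<phi> G \<subseteq> \<phi> F))"
proof -
  \<comment> \<open>The intersection over a face equals the tight set of any point generating that
    face, so no choice of a generating point is needed.\<close>
  define \<phi> where "\<phi> F = \<Inter> (tight g K ` F)" for F
  define face where "face x = {y \<in> P. tight g K x \<subseteq> tight g K y}" for x
  have faces: "{F. F face_of P \<and> F \<noteq> {}} = face ` P"
    using face_of_constraint_set[OF assms] unfolding face_def by auto
  have \<phi>: "\<phi> (face x) = tight g K x" if "x \<in> P" for x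
  proof (rule antisym)
    have "x \<in> face x" using that unfolding face_def by simp
    then show "\<phi> (face x) \<subseteq> tight g K x" unfolding \<phi>_def by (rule INT_lower)
    show "tight g K x \<subseteq> \<phi> (face x)" unfolding \<phi>_def face_def by (rule INT_greatest) simp
  qed
  have sub: "face x \<subseteq> face y \<longleftrightarrow> \<phi> (face y) \<subseteq> \<phi> (face x)" if "x \<in> P" "y \<in> P" for x y
  proof -
    have "face x \<subseteq> face y \<longleftrightarrow> tight g K y \<subseteq> tight g K x" using that unfolding face_def by auto
    then show ?thesis by (simp only: \<phi>[OF that(1)] \<phi>[OF that(2)])
  qed
  have "inj_on \<phi> (face ` P)"
  proof (rule inj_onI)
    fix F G assume "F \<in> face ` P" "G \<in> face ` P" "\<phi> F = \<phi> G"
    then show "F = G" using sub by (metis (no_types, lifting) imageE order_refl subset_antisym)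
  qed
  moreover have "\<phi> ` face ` P = tight g K ` P" using \<phi> by (force simp: image_image)
  ultimately have "bij_betw \<phi> {F. F face_of P \<and> F \<noteq> {}} (tight g K ` P)"
    unfolding faces bij_betw_def by auto
  moreover have "F \<subseteq> G \<longleftrightarrow> \<phi> G \<subseteq> \<phi> F"
    if "F face_of P \<and> F \<noteq> {} \<and> G face_of P \<and> G \<noteq> {}" for F G
  proof -
    have "F \<in> face ` P" "G \<in> face ` P" using that faces by blast+
    then show ?thesis using sub by blast
  qed
  ultimately show ?thesis by blast
qed

text \<open>The height has coefficient 1, so over \<open>Q\<close> such a functional is minimal only
  on the graph of \<open>g\<close>. The cap \<open>M\<close> bounds the heights from above without
  cutting off any point of the graph.\<close>

lemma lower_faces_epigraph:
  fixes P :: "'a::euclidean_space set" and g :: "'a \<Rightarrow> real"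
  assumes Q: "Q = {(x, t). x \<in> P \<and> g x \<le> t \<and> t \<le> M}"
    and M: "\<And>x. x \<in> P \<Longrightarrow> g x \<le> M"
  shows "(\<lambda>F. fst ` F) ` lower_faces Q =
     {C. C \<noteq> {} \<and> (\<exists>c. C = {x \<in> P. \<forall>y\<in>P. c \<bullet> x + g x \<le> c \<bullet> y + g y})}"
proof -
  have *: "fst ` {z \<in> Q. \<forall>w\<in>Q. c \<bullet> fst z + snd z \<le> c \<bullet> fst w + snd w} =
        {x \<in> P. \<forall>y\<in>P. c \<bullet> x + g x \<le> c \<bullet> y + g y}" for c
  proof (intro equalityI subsetI)
    fix x assume "x \<in> fst ` {z \<in> Q. \<forall>w\<in>Q. c \<bullet> fst z + snd z \<le> c \<bullet> fst w + snd w}"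
    then obtain t where t: "x \<in> P" "g x \<le> t" "\<forall>w\<in>Q. c \<bullet> x + t \<le> c \<bullet> fst w + snd w"
      unfolding Q by auto
    have "c \<bullet> x + g x \<le> c \<bullet> y + g y" if "y \<in> P" for y
    proof -
      have "(y, g y) \<in> Q" using that M Q by auto
      then show ?thesis using t by force
    qed
    then show "x \<in> {x \<in> P. \<forall>y\<in>P. c \<bullet> x + g x \<le> c \<bullet> y + g y}" using t by auto
  next
    fix x assume x: "x \<in> {x \<in> P. \<forall>y\<in>P. c \<bullet> x + g x \<le> c \<bullet> y + g y}"
    then have "(x, g x) \<in> {z \<in> Q. \<forall>w\<in>Q. c \<bullet> fst z + snd z \<le> c \<bullet> fst w + snd w}"
      unfolding Q using M by force
    then show "x \<in> fst ` {z \<in> Q. \<forall>w\<in>Q. c \<bullet> fst z + snd z \<le> c \<bullet> fst w + snd w}"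
      by force
  qed
  show ?thesis
  proof (intro equalityI subsetI)
    fix C assume "C \<in> (\<lambda>F. fst ` F) ` lower_faces Q"
    then obtain F where F: "F \<in> lower_faces Q" and C: "C = fst ` F" by (rule imageE)
    obtain c where "F \<noteq> {}"
      and c: "F = {z \<in> Q. \<forall>w\<in>Q. c \<bullet> fst z + snd z \<le> c \<bullet> fst w + snd w}"
      using F unfolding lower_faces_def mem_Collect_eq by (elim conjE exE)
    have "C = {x \<in> P. \<forall>y\<in>P. c \<bullet> x + g x \<le> c \<bullet> y + g y}" unfolding C c by (rule *)
    moreover have "C \<noteq> {}" using \<open>F \<noteq> {}\<close> C by simp
    ultimately show "C \<in> {C. C \<noteq> {} \<and> (\<exists>c. C = {x \<in> P. \<forall>y\<in>P. c \<bullet> x + g x \<le> c \<bullet> y + g y})}"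
      unfolding mem_Collect_eq by (intro conjI exI)
  next
    fix C assume "C \<in> {C. C \<noteq> {} \<and> (\<exists>c. C = {x \<in> P. \<forall>y\<in>P. c \<bullet> x + g x \<le> c \<bullet> y + g y})}"
    then obtain c where c: "C \<noteq> {}" "C = {x \<in> P. \<forall>y\<in>P. c \<bullet> x + g x \<le> c \<bullet> y + g y}"
      unfolding mem_Collect_eq by (elim conjE exE)
    define F where "F = {z \<in> Q. \<forall>w\<in>Q. c \<bullet> fst z + snd z \<le> c \<bullet> fst w + snd w}"
    have C: "C = fst ` F" unfolding F_def c(2) by (rule *[symmetric])
    moreover have "F \<in> lower_faces Q"
      unfolding lower_faces_def mem_Collect_eq using F_def c(1) C by (intro conjI exI) auto
    ultimately show "C \<in> (\<lambda>F. fst ` F) ` lower_faces Q" by (rule image_eqI)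
  qed
qed

section \<open>Noncrossing sets as tight sets\<close>

text \<open>The pairs are arcs over \<open>V\<close>; an arc that ends where another begins already
  counts as crossing it. Induction on the size of \<open>V\<close>: an arc \<open>(a, b)\<close>
  other than the outer one splits \<open>V\<close>, solutions for the two parts are glued at
  \<open>a\<close>, and the strict Monge inequality keeps every arc crossing \<open>(a, b)\<close>
  slack.\<close>

lemma noncrossing_set_is_tight_set:
  fixes V :: "nat set" and c :: "nat \<Rightarrow> nat \<Rightarrow> real"
  assumes "finite V"
    and "\<And>s. s \<in> V \<Longrightarrow> c s s = 0"
    and "\<And>s s' k k'. \<lbrakk>s \<in> V; s' \<in> V; k \<in> V; k' \<in> V; s < s'; s' \<le> k; k < k'\<rbrakk>
           \<Longrightarrow> c s k' + c s' k < c s k + c s' k'"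
    and "D \<subseteq> {(s, k). s \<in> V \<and> k \<in> V \<and> s < k}"
    and "\<And>s k s' k'. \<lbrakk>(s, k) \<in> D; (s', k') \<in> D; s < s'; s' \<le> k; k < k'\<rbrakk> \<Longrightarrow> False"
    and "(Min V, Max V) \<in> D"
  shows "\<exists>x. \<forall>s\<in>V. \<forall>k\<in>V. s < k \<longrightarrow>
           x k - x s \<le> c s k \<and> (x k - x s = c s k \<longleftrightarrow> (s, k) \<in> D)"
  using assms
proof (induction "card V" arbitrary: V c D rule: less_induct)
  case less
  note fin = less.prems(1) and diag = less.prems(2) and monge = less.prems(3)
  define valid where "valid E \<longleftrightarrow>
      E \<subseteq> {(s, k). s \<in> V \<and> k \<in> V \<and> s < k} \<and>
      (\<forall>s k s' k'. (s, k) \<in> E \<longrightarrow> (s', k') \<in> E \<longrightarrow> \<not> (s < s' \<and> s' \<le> k \<and> k < k')) \<and>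
      (Min V, Max V) \<in> E" for E
  \<comment> \<open>This is stated for any valid \<open>E\<close>, because the case where
    \<open>D\<close> holds only the outer arc applies it to two larger sets.\<close>
  have step: "\<exists>x. \<forall>s\<in>V. \<forall>k\<in>V. s < k \<longrightarrow>
           x k - x s \<le> c s k \<and> (x k - x s = c s k \<longleftrightarrow> (s, k) \<in> E)"
    if valid: "valid E" and abE: "(a, b) \<in> E" and ab_ne: "(a, b) \<noteq> (Min V, Max V)" for E a b
  proof -
    have sub: "\<And>s k. (s, k) \<in> E \<Longrightarrow> s \<in> V \<and> k \<in> V \<and> s < k"
      and nc: "\<And>s k s' k'. (s, k) \<in> E \<Longrightarrow> (s', k') \<in> E \<Longrightarrow> s < s' \<Longrightarrow> s' \<le> k \<Longrightarrow> k < k' \<Longrightarrow> False"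
      and mm: "(Min V, Max V) \<in> E"
      using valid unfolding valid_def by blast+
    have ab: "a \<in> V" "b \<in> V" "a < b" using sub[OF abE] by auto
    \<comment> \<open>\<open>L\<close> is the part spanned by the arc; in \<open>R\<close> that part
      is contracted to its left end \<open>a\<close>.\<close>
    define L where "L = V \<inter> {a..b}"
    define R where "R = V - {a<..b}"
    \<comment> \<open>Right of the split the endpoint \<open>b\<close> is replaced by \<open>a\<close>, since \<open>x b = x a + c a b\<close>.\<close>
    define c' where "c' s k = (if k = a then c s b - c a b else c s k)" for s k
    define EL where "EL = {(s, k). (s, k) \<in> E \<and> s \<in> L \<and> k \<in> L}"
    define ER where "ER = {(s, k). s \<in> R \<and> k \<in> R \<and> s < k \<and> (s, if k = a then b else k) \<in> E}"
    have minmax: "Min V \<in> V" "Max V \<in> V" "\<And>v. v \<in> V \<Longrightarrow> Min V \<le> v \<and> v \<le> Max V"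
      using fin ab by (auto intro: Min_in Max_in)
    have "L \<noteq> V" using ab_ne minmax ab unfolding L_def
      by (metis Int_iff atLeastAtMost_iff le_antisym)
    then have cardL: "card L < card V" using fin unfolding L_def by (intro psubset_card_mono) auto
    have cardR: "card R < card V" using fin ab unfolding R_def by (intro psubset_card_mono) auto
    have L: "Min L = a" "Max L = b" "finite L" "a \<in> L" "b \<in> L"
      using fin ab unfolding L_def by (auto intro!: Min_eqI Max_eqI)
    have R: "finite R" "a \<in> R" using fin ab unfolding R_def by auto
    have exL: "\<exists>x. \<forall>s\<in>L. \<forall>k\<in>L. s < k \<longrightarrow>
           x k - x s \<le> c s k \<and> (x k - x s = c s k \<longleftrightarrow> (s, k) \<in> EL)"
    proof (rule less.hyps[OF cardL L(3)])
      show "\<And>s. s \<in> L \<Longrightarrow> c s s = 0" using diag unfolding L_def by auto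
      show "\<And>s s' k k'. \<lbrakk>s \<in> L; s' \<in> L; k \<in> L; k' \<in> L; s < s'; s' \<le> k; k < k'\<rbrakk>
           \<Longrightarrow> c s k' + c s' k < c s k + c s' k'" using monge unfolding L_def by blast
      show "EL \<subseteq> {(s, k). s \<in> L \<and> k \<in> L \<and> s < k}" using sub unfolding EL_def by auto
      show "\<And>s k s' k'. \<lbrakk>(s, k) \<in> EL; (s', k') \<in> EL; s < s'; s' \<le> k; k < k'\<rbrakk> \<Longrightarrow> False"
        using nc unfolding EL_def by blast
      show "(Min L, Max L) \<in> EL" using L abE unfolding EL_def by auto
    qed
    then obtain x1 where x1: "\<And>s k. \<lbrakk>s \<in> L; k \<in> L; s < k\<rbrakk> \<Longrightarrow> x1 k - x1 s \<le> c s k"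
      "\<And>s k. \<lbrakk>s \<in> L; k \<in> L; s < k\<rbrakk> \<Longrightarrow> x1 k - x1 s = c s k \<longleftrightarrow> (s, k) \<in> E"
      unfolding EL_def by blast
    have exR: "\<exists>x. \<forall>s\<in>R. \<forall>k\<in>R. s < k \<longrightarrow>
           x k - x s \<le> c' s k \<and> (x k - x s = c' s k \<longleftrightarrow> (s, k) \<in> ER)"
    proof (rule less.hyps[OF cardR R(1)])
      show "c' s s = 0" if "s \<in> R" for s using diag that unfolding R_def c'_def by auto
      \<comment> \<open>As a right end, \<open>a\<close> is read as \<open>b\<close>. Elements of
        \<open>R\<close> above \<open>a\<close> are above \<open>b\<close>, so the order of right
        ends survives this reading, and the constant \<open>c a b\<close> occurs equally on both
        sides.\<close>
      show "c' s k' + c' s' k < c' s k + c' s' k'"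
        if kk: "s \<in> R" "s' \<in> R" "k \<in> R" "k' \<in> R" "s < s'" "s' \<le> k" "k < k'" for s s' k k'
      proof -
        have *: "s \<in> V" "s' \<in> V" "k \<in> V" "k' \<in> V" using that unfolding R_def by auto
        consider "k = a" "k' \<noteq> a" | "k' = a" "k \<noteq> a" | "k \<noteq> a" "k' \<noteq> a" using kk(7) by (metis less_irrefl)
        then show ?thesis
        proof cases
          case 1
          then have "b < k'" using that unfolding R_def by auto
          then show ?thesis using monge[of s s' b k'] * that ab 1 unfolding c'_def by auto
        next
          case 2
          then show ?thesis using monge[of s s' k b] * that ab unfolding c'_def by auto
        next
          case 3
          then show ?thesis using monge[of s s' k k'] * that unfolding c'_def by auto
        qed
      qed
      show "ER \<subseteq> {(s, k). s \<in> R \<and> k \<in> R \<and> s < k}" unfolding ER_def by auto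
      show False if "(s, k) \<in> ER" "(s', k') \<in> ER" "s < s'" "s' \<le> k" "k < k'" for s k s' k'
      proof -
        have "k = a \<Longrightarrow> b < k'" using that unfolding ER_def R_def by auto
        then show False
          using nc[of s "if k = a then b else k" s' "if k' = a then b else k'"] that ab
          unfolding ER_def by (auto split: if_splits)
      qed
      show "(Min R, Max R) \<in> ER"
      proof -
        have "Min V \<le> a" using minmax(3)[of a] ab by auto
        then have mV: "Min V \<in> R" using minmax(1) ab unfolding R_def by auto
        then have mR: "Min R = Min V"
          using minmax(3) R by (intro Min_eqI) (auto simp: R_def)
        show ?thesis
        proof (cases "b = Max V")
          case True
          \<comment> \<open>The outer arc of \<open>R\<close> now ends in \<open>a\<close>; read
            with right end \<open>b\<close> it is the outer arc of \<open>V\<close>.\<close>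
          then have "Max R = a"
            using minmax R by (intro Max_eqI) (auto simp: R_def)
          moreover have "Min V < a" using True ab_ne minmax(3)[of a] ab by auto
          ultimately show ?thesis using mR mV R mm True unfolding ER_def by auto
        next
          case False
          then have "b < Max V" using minmax(3)[of b] ab by auto
          then have "Max R = Max V" "Max V \<in> R"
            using minmax R ab by (auto intro!: Max_eqI simp: R_def)
          then show ?thesis using mR mV mm ab \<open>b < Max V\<close> sub[OF mm] unfolding ER_def by auto
        qed
      qed
    qed
    then obtain x2 where x2R: "\<forall>s\<in>R. \<forall>k\<in>R. s < k \<longrightarrow>
           x2 k - x2 s \<le> c' s k \<and> (x2 k - x2 s = c' s k \<longleftrightarrow> (s, k) \<in> ER)" ..
    have x2: "\<And>s k. \<lbrakk>s \<in> R; k \<in> R; s < k\<rbrakk> \<Longrightarrow> x2 k - x2 s \<le> c' s k"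
      "\<And>s k. \<lbrakk>s \<in> R; k \<in> R; s < k\<rbrakk> \<Longrightarrow> x2 k - x2 s = c' s k \<longleftrightarrow> (s, if k = a then b else k) \<in> E"
      using x2R unfolding ER_def by simp_all
    \<comment> \<open>The left solution is shifted to agree with the right one at \<open>a\<close>;
      only differences matter, so it still solves the left part.\<close>
    define x where "x v = (if v \<in> {a<..b} then x1 v - x1 a + x2 a else x2 v)" for v
    have xL: "x k - x s \<le> c s k" "x k - x s = c s k \<longleftrightarrow> (s, k) \<in> E"
      if "s \<in> L" "k \<in> L" "s < k" for s k
      using x1(1)[OF that] x1(2)[OF that] that unfolding x_def L_def
      by (auto split: if_splits)
    have xR: "x k - x s \<le> c' s k" "x k - x s = c' s k \<longleftrightarrow> (s, if k = a then b else k) \<in> E"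
      if "s \<in> R" "k \<in> R" "s < k" for s k
      using x2(1)[OF that] x2(2)[OF that] that unfolding x_def R_def by auto
    have xab: "x b - x a = c a b" using xL(2)[of a b] L ab abE by auto
    show ?thesis
    proof (intro exI[of _ x] ballI impI)
      fix s k assume sk: "s \<in> V" "k \<in> V" "s < k"
      have strict: "x k - x s \<le> c s k \<and> (x k - x s = c s k \<longleftrightarrow> (s, k) \<in> E)"
        if "x k - x s < c s k" "(s, k) \<notin> E" using that by auto
      \<comment> \<open>In cases 1, 2 and 4 both the bound and its tightness come from one of the
        two parts. In cases 3, 5 and 6 the pair crosses \<open>(a, b)\<close>, hence is not in
        \<open>E\<close>, and the bounds from the parts combined with strict Monge give a strict
        inequality.\<close>
      consider "s \<in> L" "k \<in> L" | "s \<in> R" "k \<in> R" "k \<noteq> a" | "s < a" "k = a" | "s < a" "k = b"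
        | "s < a" "a < k" "k < b" | "a < s" "s \<le> b" "b < k"
        using sk unfolding L_def R_def Int_iff Diff_iff atLeastAtMost_iff greaterThanAtMost_iff
        by linarith
      then show "x k - x s \<le> c s k \<and> (x k - x s = c s k \<longleftrightarrow> (s, k) \<in> E)"
      proof cases
        case 1
        then show ?thesis using xL sk by auto
      next
        case 2
        then show ?thesis using xR[of s k] sk unfolding c'_def by auto
      next
        case 3
        then have "s \<in> R" using sk unfolding R_def by auto
        then have "x a - x s \<le> c s b - c a b" using xR(1)[of s a] R 3 unfolding c'_def by auto
        moreover have "c s b + c a a < c s a + c a b" using monge[of s a a b] sk 3 ab by auto
        moreover have "(s, a) \<notin> E" using nc[of s a a b] 3 ab abE by auto
        ultimately show ?thesis using strict diag[of a] ab 3 by auto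
      next
        case 4
        then have "s \<in> R" using sk unfolding R_def by auto
        then show ?thesis using xR[of s a] R 4 xab unfolding c'_def by auto
      next
        case 5
        then have "s \<in> R" "k \<in> L" using sk unfolding R_def L_def by auto
        then have "x a - x s \<le> c s b - c a b" "x k - x a \<le> c a k"
          using xR(1)[of s a] xL(1)[of a k] R L 5 unfolding c'_def by auto
        moreover have "c s b + c a k < c s k + c a b" using monge[of s a k b] sk 5 ab by auto
        moreover have "(s, k) \<notin> E" using nc[of s k a b] 5 ab abE by auto
        ultimately show ?thesis using strict by auto
      next
        case 6
        then have "k \<in> R" "s \<in> L" using sk ab unfolding R_def L_def by auto
        then have "x k - x a \<le> c a k" using xR(1)[of a k] R 6 ab unfolding c'_def by auto
        moreover have "x b - x s \<le> c s b"
        proof (cases "s = b")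
          case True
          then show ?thesis using diag[of b] ab by auto
        next
          case False
          then show ?thesis using xL(1)[of s b] \<open>s \<in> L\<close> L 6 by auto
        qed
        moreover have "c a k + c s b < c a b + c s k" using monge[of a s b k] sk 6 ab by auto
        moreover have "(s, k) \<notin> E" using nc[of a b s k] 6 ab abE by auto
        ultimately show ?thesis using strict xab by auto
      qed
    qed
  qed
  have D: "valid D" using less.prems(4-6) unfolding valid_def by blast
  show ?case
  proof (cases "\<exists>a b. (a, b) \<in> D \<and> (a, b) \<noteq> (Min V, Max V)")
    case True
    then obtain a b where "(a, b) \<in> D" "(a, b) \<noteq> (Min V, Max V)" by blast
    then show ?thesis by (rule step[OF D])
  next
    case False
    then have "p = (Min V, Max V)" if "p \<in> D" for p
      using that by (cases p) blast
    then have DD: "D = {(Min V, Max V)}" using less.prems(6) by blast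
    have mM: "Min V \<in> V" "Max V \<in> V" "Min V < Max V" using less.prems(4,6) by auto
    have bd: "\<And>v. v \<in> V \<Longrightarrow> Min V \<le> v \<and> v \<le> Max V" using fin by auto
    show ?thesis
    proof (cases "\<exists>v\<in>V. v \<noteq> Min V \<and> v \<noteq> Max V")
      case True
      then obtain v where v: "v \<in> V" "Min V < v" "v < Max V" using bd order_less_le by metis
      \<comment> \<open>The two extra arcs meet at \<open>v\<close> and differ from each other, so
        averaging the two solutions leaves tight only the arc that both share, the outer
        one.\<close>
      have "valid {(Min V, Max V), (Min V, v)}" "valid {(Min V, Max V), (v, Max V)}"
        unfolding valid_def using v mM by auto
      then have "\<exists>x. \<forall>s\<in>V. \<forall>k\<in>V. s < k \<longrightarrow>
           x k - x s \<le> c s k \<and> (x k - x s = c s k \<longleftrightarrow> (s, k) \<in> {(Min V, Max V), (Min V, v)})"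
        "\<exists>x. \<forall>s\<in>V. \<forall>k\<in>V. s < k \<longrightarrow>
           x k - x s \<le> c s k \<and> (x k - x s = c s k \<longleftrightarrow> (s, k) \<in> {(Min V, Max V), (v, Max V)})"
        using step[of "{(Min V, Max V), (Min V, v)}" "Min V" v]
          step[of "{(Min V, Max V), (v, Max V)}" v "Max V"] v by auto
      then obtain x1 x2 where x1: "\<forall>s\<in>V. \<forall>k\<in>V. s < k \<longrightarrow>
           x1 k - x1 s \<le> c s k \<and> (x1 k - x1 s = c s k \<longleftrightarrow> (s, k) \<in> {(Min V, Max V), (Min V, v)})"
        and x2: "\<forall>s\<in>V. \<forall>k\<in>V. s < k \<longrightarrow>
           x2 k - x2 s \<le> c s k \<and> (x2 k - x2 s = c s k \<longleftrightarrow> (s, k) \<in> {(Min V, Max V), (v, Max V)})"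
        by blast
      define x where "x w = (x1 w + x2 w) / 2" for w
      show ?thesis
      proof (intro exI[of _ x] ballI impI)
        fix s k assume "s \<in> V" "k \<in> V" "s < k"
        then have "x1 k - x1 s \<le> c s k" "x1 k - x1 s = c s k \<longleftrightarrow> (s, k) \<in> {(Min V, Max V), (Min V, v)}"
          "x2 k - x2 s \<le> c s k" "x2 k - x2 s = c s k \<longleftrightarrow> (s, k) \<in> {(Min V, Max V), (v, Max V)}"
          using x1 x2 by blast+
        moreover have "x k - x s = ((x1 k - x1 s) + (x2 k - x2 s)) / 2" unfolding x_def by argo
        moreover have "(s, k) \<in> {(Min V, Max V), (Min V, v)} \<and> (s, k) \<in> {(Min V, Max V), (v, Max V)} \<longleftrightarrow> (s, k) \<in> D"
          unfolding DD using v by auto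
        ultimately show "x k - x s \<le> c s k \<and> (x k - x s = c s k \<longleftrightarrow> (s, k) \<in> D)"
          by argo
      qed
    next
      case False
      \<comment> \<open>\<open>V\<close> now consists of its two extremes, so the outer pair is the
        only constraint.\<close>
      show ?thesis
      proof (intro exI[of _ "\<lambda>w. if w = Max V then c (Min V) (Max V) else 0"] ballI impI)
        fix s k assume "s \<in> V" "k \<in> V" "s < k"
        then have "s = Min V" "k = Max V" using False bd by (metis leD)+
        then show "(if k = Max V then c (Min V) (Max V) else 0) - (if s = Max V then c (Min V) (Max V) else 0) \<le> c s k \<and>
          ((if k = Max V then c (Min V) (Max V) else 0) - (if s = Max V then c (Min V) (Max V) else 0) = c s k \<longleftrightarrow> (s, k) \<in> D)"
          using mM DD by auto
      qed
    qed
  qed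
qed

section \<open>Cells of the arrangement\<close>

locale monge_arrangement =
  fixes I :: "nat set" and idx :: "'n::finite \<Rightarrow> nat" and h :: "nat \<Rightarrow> nat \<Rightarrow> real"
    and i0 :: nat and jm :: 'n
  assumes finite_I: "finite I" and inj_idx: "inj idx" and i0: "i0 \<in> I"
    and i0_le_I: "i \<in> I \<Longrightarrow> i0 \<le> i" and i0_le_idx: "i0 \<le> idx n"
    and idx_le_jm: "idx n \<le> idx jm" and I_le_jm: "i \<in> I \<Longrightarrow> i \<le> idx jm"
    and monge: "\<lbrakk>i \<in> I; i' \<in> I; i < i'; i' \<le> idx n; idx n < idx n'\<rbrakk>
      \<Longrightarrow> h i (idx n') + h i' (idx n) < h i (idx n) + h i' (idx n')"
begin

text \<open>A version of \<open>maximizers\<close> in real arithmetic: the indices of infinite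
  height are excluded by the guard \<open>i \<le> idx n\<close>.\<close>

definition opt :: "nat \<Rightarrow> real^'n \<Rightarrow> 'n set" where
  "opt i x = {n. i \<le> idx n \<and> (\<forall>k. i \<le> idx k \<longrightarrow> x $ k - h i (idx k) \<le> x $ n - h i (idx n))}"

definition opt_value :: "nat \<Rightarrow> real^'n \<Rightarrow> real" where
  "opt_value i x = Max ((\<lambda>n. x $ n - h i (idx n)) ` {n. i \<le> idx n})"

text \<open>Taking the closure relaxes equality of maximizing sets to inclusion;
  \<open>closure_constant_opt\<close> shows that this is the closed cell of
  \<open>x\<close>.\<close>

definition cell :: "real^'n \<Rightarrow> (real^'n) set" where
  "cell x = {y \<in> slice idx. \<forall>i\<in>I. opt i x \<subseteq> opt i y}"

text \<open>This is the combinatorial form of boundedness of \<open>cell x\<close>, see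
  \<open>bounded_cell_iff\<close>.\<close>

definition covered :: "real^'n \<Rightarrow> bool" where
  "covered x \<longleftrightarrow> (\<forall>n. \<exists>i\<in>I. n \<in> opt i x) \<and> jm \<in> opt i0 x"

lemma idx_less_jm: "n \<noteq> jm \<Longrightarrow> idx n < idx jm"
  using idx_le_jm inj_idx by (metis injD order_le_less)

lemma slice_eq: "slice idx = {x. x $ jm = 0}"
proof -
  have "Max (range idx) = idx jm" using idx_le_jm by (intro Max_eqI) auto
  then show ?thesis unfolding slice_def using inj_idx by (auto dest: injD)
qed

lemma maximizers_eq_opt:
  assumes "i \<in> I"
  shows "maximizers idx h i x = opt i x"
proof (intro equalityI subsetI)
  fix n assume n: "n \<in> maximizers idx h i x"
  then have max: "ereal (x $ k) - h_ext h i (idx k) \<le> ereal (x $ n) - h_ext h i (idx n)" for k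
    unfolding maximizers_def by auto
  have "i \<le> idx n"
  proof (rule ccontr)
    assume "\<not> i \<le> idx n"
    then show False using max[of jm] I_le_jm[OF assms] unfolding h_ext_def by auto
  qed
  moreover have "x $ k - h i (idx k) \<le> x $ n - h i (idx n)" if "i \<le> idx k" for k
    using max[of k] that \<open>i \<le> idx n\<close> unfolding h_ext_def by auto
  ultimately show "n \<in> opt i x" unfolding opt_def by auto
next
  fix n assume "n \<in> opt i x"
  then show "n \<in> maximizers idx h i x" unfolding opt_def maximizers_def h_ext_def by auto
qed

lemma opt_value_ge: "i \<le> idx n \<Longrightarrow> x $ n - h i (idx n) \<le> opt_value i x"
  unfolding opt_value_def by (intro Max_ge) auto

lemma opt_value_attained:
  assumes "i \<in> I"
  obtains n where "i \<le> idx n" "x $ n - h i (idx n) = opt_value i x"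
proof -
  have "opt_value i x \<in> (\<lambda>n. x $ n - h i (idx n)) ` {n. i \<le> idx n}"
    unfolding opt_value_def using I_le_jm[OF assms] by (intro Max_in) auto
  then show ?thesis using that by auto
qed

lemma opt_iff:
  assumes "i \<in> I"
  shows "n \<in> opt i x \<longleftrightarrow> i \<le> idx n \<and> x $ n - h i (idx n) = opt_value i x"
proof -
  obtain k where "i \<le> idx k" "x $ k - h i (idx k) = opt_value i x"
    using opt_value_attained[OF assms] by blast
  then show ?thesis using opt_value_ge[of i _ x] unfolding opt_def by force
qed

lemma opt_nonempty: "i \<in> I \<Longrightarrow> opt i x \<noteq> {}"
  using opt_iff opt_value_attained by (metis empty_iff)

lemma opt_value_le:
  "\<lbrakk>i \<in> I; \<And>n. i \<le> idx n \<Longrightarrow> x $ n - h i (idx n) \<le> b\<rbrakk> \<Longrightarrow> opt_value i x \<le> b"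
  using opt_value_attained by metis

text \<open>Both \<open>n\<close> and \<open>n'\<close> compete in both rows, as
  \<open>i' \<le> idx n\<close>; adding the two optimality inequalities contradicts Monge.\<close>

lemma opt_noncrossing:
  assumes "i \<in> I" "i' \<in> I" "n \<in> opt i x" "n' \<in> opt i' x" "i < i'" "i' \<le> idx n" "idx n < idx n'"
  shows False
proof -
  have "x $ n' - h i (idx n') \<le> x $ n - h i (idx n)" "x $ n - h i' (idx n) \<le> x $ n' - h i' (idx n')"
    using assms unfolding opt_def by auto
  then show False using monge[of i i' n n'] assms by auto
qed

lemma opt_value_convex_combination:
  assumes "0 \<le> u" "u \<le> 1" "i \<in> I"
  shows "opt_value i ((1 - u) *\<^sub>R a + u *\<^sub>R b) \<le> (1 - u) * opt_value i a + u * opt_value i b"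
proof (rule opt_value_le[OF assms(3)])
  fix n assume "i \<le> idx n"
  then have "(1 - u) * (a $ n - h i (idx n)) + u * (b $ n - h i (idx n))
      \<le> (1 - u) * opt_value i a + u * opt_value i b"
    using assms by (intro add_mono mult_left_mono opt_value_ge) auto
  then show "((1 - u) *\<^sub>R a + u *\<^sub>R b) $ n - h i (idx n) \<le> (1 - u) * opt_value i a + u * opt_value i b"
    by (simp add: algebra_simps)
qed

text \<open>A term that is maximal at the inner point has nonnegative deficits at the two ends.
  Their weighted sum vanishes when \<open>opt_value i\<close> interpolates linearly, so both
  deficits are zero.\<close>

lemma opt_subset_endpoints:
  assumes "0 < u" "u < 1" "i \<in> I"
    and eq: "opt_value i ((1 - u) *\<^sub>R a + u *\<^sub>R b) = (1 - u) * opt_value i a + u * opt_value i b"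
  shows "opt i ((1 - u) *\<^sub>R a + u *\<^sub>R b) \<subseteq> opt i a \<inter> opt i b"
proof
  fix n assume "n \<in> opt i ((1 - u) *\<^sub>R a + u *\<^sub>R b)"
  then have n: "i \<le> idx n"
    "((1 - u) *\<^sub>R a + u *\<^sub>R b) $ n - h i (idx n) = (1 - u) * opt_value i a + u * opt_value i b"
    using opt_iff[OF assms(3)] eq by auto
  have ge: "0 \<le> opt_value i a - (a $ n - h i (idx n))" "0 \<le> opt_value i b - (b $ n - h i (idx n))"
    using opt_value_ge[OF n(1), of a] opt_value_ge[OF n(1), of b] by auto
  have "(1 - u) * (opt_value i a - (a $ n - h i (idx n))) + u * (opt_value i b - (b $ n - h i (idx n))) = 0"
    using n(2) by (simp add: algebra_simps)
  moreover have "0 \<le> (1 - u) * (opt_value i a - (a $ n - h i (idx n)))"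
    "0 \<le> u * (opt_value i b - (b $ n - h i (idx n)))"
    using ge assms by auto
  ultimately have "(1 - u) * (opt_value i a - (a $ n - h i (idx n))) = 0"
    "u * (opt_value i b - (b $ n - h i (idx n))) = 0" by linarith+
  then show "n \<in> opt i a \<inter> opt i b" using assms n(1) opt_iff[OF assms(3)] by auto
qed

text \<open>One index from \<open>opt i x\<close> is maximizing at both \<open>a\<close> and
  \<open>b\<close>, and its term is affine. With \<open>opt_value_convex_combination\<close> this
  makes \<open>opt_value i\<close> affine along segments of a cell.\<close>

lemma opt_value_concave_on_cell:
  assumes "i \<in> I" "a \<in> cell x" "b \<in> cell x"
  shows "opt_value i ((1 - u) *\<^sub>R a + u *\<^sub>R b) \<ge> (1 - u) * opt_value i a + u * opt_value i b"
proof -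
  obtain n where "n \<in> opt i x" using opt_nonempty[OF assms(1)] by blast
  then have "n \<in> opt i a" "n \<in> opt i b" using assms unfolding cell_def by auto
  then have "i \<le> idx n" "a $ n - h i (idx n) = opt_value i a" "b $ n - h i (idx n) = opt_value i b"
    using opt_iff[OF assms(1)] by auto
  moreover have "((1 - u) *\<^sub>R a + u *\<^sub>R b) $ n - h i (idx n) =
     (1 - u) * (a $ n - h i (idx n)) + u * (b $ n - h i (idx n))" by (simp add: algebra_simps)
  ultimately show ?thesis using opt_value_ge by metis
qed

section \<open>Cells as polyhedra and their faces\<close>

definition cell_constraint :: "nat \<times> 'n \<times> 'n \<Rightarrow> real^'n \<Rightarrow> real" where
  "cell_constraint = (\<lambda>(i, n, k) y. (y $ k - h i (idx k)) - (y $ n - h i (idx n)))"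

definition cell_indices :: "real^'n \<Rightarrow> (nat \<times> 'n \<times> 'n) set" where
  "cell_indices x = {(i, n, k). i \<in> I \<and> n \<in> opt i x \<and> i \<le> idx k}"

lemma finite_cell_indices: "finite (cell_indices x)"
proof (rule finite_subset)
  show "cell_indices x \<subseteq> I \<times> UNIV" unfolding cell_indices_def by auto
qed (use finite_I in simp)

lemma affine_map_cell_constraint: "affine_map (cell_constraint q)"
  unfolding cell_constraint_def by (cases q) (simp add: affine_map_intros)

lemma cell_eq_constraint_set: "cell x = {y \<in> slice idx. \<forall>q\<in>cell_indices x. cell_constraint q y \<le> 0}"
proof (intro equalityI subsetI)
  fix y assume "y \<in> cell x"
  then show "y \<in> {y \<in> slice idx. \<forall>q\<in>cell_indices x. cell_constraint q y \<le> 0}"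
    unfolding cell_def cell_indices_def cell_constraint_def opt_def by force
next
  fix y assume y: "y \<in> {y \<in> slice idx. \<forall>q\<in>cell_indices x. cell_constraint q y \<le> 0}"
  have "n \<in> opt i y" if "i \<in> I" "n \<in> opt i x" for i n
  proof -
    have "i \<le> idx n" using that unfolding opt_def by auto
    moreover have "y $ k - h i (idx k) \<le> y $ n - h i (idx n)" if "i \<le> idx k" for k
    proof -
      have "(i, n, k) \<in> cell_indices x"
        using that \<open>i \<in> I\<close> \<open>n \<in> opt i x\<close> unfolding cell_indices_def by auto
      then have "cell_constraint (i, n, k) y \<le> 0" using y by blast
      then show ?thesis unfolding cell_constraint_def by auto
    qed
    ultimately show ?thesis unfolding opt_def by auto
  qed
  then show "y \<in> cell x" using y unfolding cell_def by auto
qed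

lemma cell_constraint_eq_0_iff:
  assumes "y \<in> cell x" "i \<in> I" "n \<in> opt i x" "i \<le> idx k"
  shows "cell_constraint (i, n, k) y = 0 \<longleftrightarrow> k \<in> opt i y"
proof -
  have "n \<in> opt i y" using assms unfolding cell_def by auto
  then have "y $ n - h i (idx n) = opt_value i y" using opt_iff[OF assms(2)] by auto
  then show ?thesis using opt_iff[OF assms(2)] assms(4) unfolding cell_constraint_def by auto
qed

text \<open>The constraint \<open>(i, n, k)\<close> compares \<open>k\<close> with an index
  \<open>n\<close> that stays maximizing on the cell, so it is tight exactly where \<open>k\<close>
  becomes maximizing too. Every row has such an \<open>n\<close>, so tight sets carry the same
  information as maximizing sets.\<close>

lemma tight_cell_subset_iff:
  assumes "y \<in> cell x" "z \<in> cell x"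
  shows "tight cell_constraint (cell_indices x) y \<subseteq> tight cell_constraint (cell_indices x) z
    \<longleftrightarrow> (\<forall>i\<in>I. opt i y \<subseteq> opt i z)"
proof
  assume L: "tight cell_constraint (cell_indices x) y \<subseteq> tight cell_constraint (cell_indices x) z"
  show "\<forall>i\<in>I. opt i y \<subseteq> opt i z"
  proof (intro ballI subsetI)
    fix i k assume i: "i \<in> I" and k: "k \<in> opt i y"
    obtain n where n: "n \<in> opt i x" using opt_nonempty[OF i] by blast
    have ik: "i \<le> idx k" using k unfolding opt_def by auto
    then have "(i, n, k) \<in> tight cell_constraint (cell_indices x) y"
      using cell_constraint_eq_0_iff[OF assms(1) i n ik] k i n
      unfolding tight_def cell_indices_def by auto
    then show "k \<in> opt i z"
      using L cell_constraint_eq_0_iff[OF assms(2) i n ik] unfolding tight_def by auto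
  qed
next
  assume "\<forall>i\<in>I. opt i y \<subseteq> opt i z"
  then show "tight cell_constraint (cell_indices x) y \<subseteq> tight cell_constraint (cell_indices x) z"
    using cell_constraint_eq_0_iff[OF assms(1)] cell_constraint_eq_0_iff[OF assms(2)]
    unfolding tight_def cell_indices_def by blast
qed

lemma affine_slice: "affine (slice idx)"
  unfolding affine_def slice_eq by auto

lemma cell_self: "x \<in> slice idx \<Longrightarrow> x \<in> cell x"
  unfolding cell_def by auto

lemma cell_subset_slice: "cell x \<subseteq> slice idx"
  unfolding cell_def by auto

lemma cell_mono: "y \<in> cell x \<Longrightarrow> cell y \<subseteq> cell x"
  unfolding cell_def by blast

text \<open>In terms of maximizing sets, the face generated by a point \<open>y\<close> of the cell
  consists of the points whose maximizing sets contain those of \<open>y\<close>, which is the cell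
  of \<open>y\<close>.\<close>

lemma face_of_cell: "F face_of cell x \<and> F \<noteq> {} \<longleftrightarrow> F \<in> cell ` cell x"
proof -
  have "{z \<in> cell x. tight cell_constraint (cell_indices x) y \<subseteq> tight cell_constraint (cell_indices x) z} = cell y"
    if y: "y \<in> cell x" for y
  proof -
    have "{z \<in> cell x. tight cell_constraint (cell_indices x) y \<subseteq> tight cell_constraint (cell_indices x) z}
       = {z \<in> cell x. \<forall>i\<in>I. opt i y \<subseteq> opt i z}"
      using tight_cell_subset_iff[OF y] by blast
    also have "\<dots> = cell y" using cell_mono[OF y] unfolding cell_def by auto
    finally show ?thesis .
  qed
  then show ?thesis
    using face_of_constraint_set[OF affine_slice finite_cell_indices[of x]
        affine_map_cell_constraint cell_eq_constraint_set[of x], of F] by auto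
qed

lemma polyhedron_slice: "polyhedron (slice idx)"
proof -
  have "slice idx = {y. axis jm 1 \<bullet> y = 0}" unfolding slice_eq by (auto simp: inner_axis')
  then show ?thesis using polyhedron_hyperplane by simp
qed

lemma polyhedron_cell: "polyhedron (cell x)"
proof -
  have "cell x = slice idx \<inter> \<Inter> ((\<lambda>q. {y. cell_constraint q y \<le> 0}) ` cell_indices x)"
    unfolding cell_eq_constraint_set by auto
  then show ?thesis
    using polyhedron_slice finite_cell_indices affine_map_cell_constraint
    by (auto intro!: polyhedron_Int polyhedron_affine_map_le)
qed

lemma closure_constant_opt:
  assumes x: "x \<in> slice idx"
  shows "closure {y \<in> slice idx. \<forall>i\<in>I. maximizers idx h i y = maximizers idx h i x} = cell x"
proof -
  let ?S = "{y \<in> slice idx. \<forall>i\<in>I. maximizers idx h i y = maximizers idx h i x}"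
  have S: "?S = {y \<in> slice idx. \<forall>i\<in>I. opt i y = opt i x}" by (auto simp: maximizers_eq_opt)
  have "closure ?S \<subseteq> cell x"
  proof (rule closure_minimal)
    show "?S \<subseteq> cell x" unfolding S cell_def by auto
    show "closed (cell x)" by (rule polyhedron_imp_closed[OF polyhedron_cell])
  qed
  moreover have "y \<in> closure ?S" if y: "y \<in> cell x" for y
  proof -
    \<comment> \<open>Moving from \<open>y\<close> any distance towards \<open>x\<close> already
      produces the maximizing sets of \<open>x\<close>; letting \<open>u\<close> tend to 0 then
      reaches \<open>y\<close> from within the set.\<close>
    have seg: "(1 - u) *\<^sub>R y + u *\<^sub>R x \<in> ?S" if u: "0 < u" "u < 1" for u
    proof -
      have "(1 - u) *\<^sub>R y + u *\<^sub>R x \<in> slice idx"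
        using affine_slice y x cell_subset_slice by (intro mem_affine) auto
      moreover have "opt i ((1 - u) *\<^sub>R y + u *\<^sub>R x) = opt i x" if i: "i \<in> I" for i
      proof -
        have eq: "opt_value i ((1 - u) *\<^sub>R y + u *\<^sub>R x) = (1 - u) * opt_value i y + u * opt_value i x"
          using opt_value_convex_combination[of u i y x] opt_value_concave_on_cell[OF i y cell_self[OF x], of u] u i
          by auto
        have "opt i x \<subseteq> opt i ((1 - u) *\<^sub>R y + u *\<^sub>R x)"
        proof
          fix n assume n: "n \<in> opt i x"
          then have "n \<in> opt i y" using y i unfolding cell_def by auto
          have "((1 - u) *\<^sub>R y + u *\<^sub>R x) $ n - h i (idx n) =
               (1 - u) * (y $ n - h i (idx n)) + u * (x $ n - h i (idx n))"
            by (simp add: algebra_simps)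
          then show "n \<in> opt i ((1 - u) *\<^sub>R y + u *\<^sub>R x)"
            using n \<open>n \<in> opt i y\<close> eq opt_iff[OF i] by auto
        qed
        then show ?thesis using opt_subset_endpoints[OF u i eq] by auto
      qed
      ultimately show ?thesis unfolding S by auto
    qed
    have lim: "((\<lambda>u. (1 - u) *\<^sub>R y + u *\<^sub>R x) \<longlongrightarrow> (1 - 0) *\<^sub>R y + 0 *\<^sub>R x) (at_right 0)"
      by (intro tendsto_intros)
    have "\<forall>\<^sub>F u in at_right (0::real). 0 < u \<and> u < 1"
      by (intro eventually_conj eventually_at_right_less order_tendstoD(2)[of "\<lambda>u. u" 0])
        (auto intro: tendsto_ident_at)
    then have "\<forall>\<^sub>F u in at_right 0. (1 - u) *\<^sub>R y + u *\<^sub>R x \<in> closure ?S"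
      by eventually_elim (use seg closure_subset in blast)
    from Lim_in_closed_set[OF closed_closure this _ lim] show ?thesis by simp
  qed
  ultimately show ?thesis by blast
qed

section \<open>Bounded cells\<close>

lemma unbounded_cell:
  fixes x v :: "real^'n"
  assumes x: "x \<in> slice idx" and v: "v \<noteq> 0" "v $ jm = 0"
    and rec: "\<And>i n k. \<lbrakk>i \<in> I; n \<in> opt i x; i \<le> idx k\<rbrakk> \<Longrightarrow> v $ k \<le> v $ n"
  shows "\<not> bounded (cell x)"
proof
  assume "bounded (cell x)"
  then obtain B where B: "\<And>y. y \<in> cell x \<Longrightarrow> norm y \<le> B" unfolding bounded_iff by auto
  \<comment> \<open>\<open>v\<close> is a recession direction: a maximizing index gains at least as
    much as each of its competitors.\<close>
  have "x + t *\<^sub>R v \<in> cell x" if "t \<ge> 0" for t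
  proof -
    have "x + t *\<^sub>R v \<in> slice idx" using x v(2) unfolding slice_eq by auto
    moreover have "n \<in> opt i (x + t *\<^sub>R v)" if i: "i \<in> I" and n: "n \<in> opt i x" for i n
    proof -
      have "t * v $ k \<le> t * v $ n" if "i \<le> idx k" for k
        using rec[OF i n that] \<open>t \<ge> 0\<close> by (rule mult_left_mono)
      then show ?thesis using n unfolding opt_def by (force simp: algebra_simps)
    qed
    ultimately show ?thesis unfolding cell_def by auto
  qed
  then have bd: "norm (x + t *\<^sub>R v) \<le> B" if "t \<ge> 0" for t using B that by auto
  define t where "t = (B + norm x + 1) / norm v"
  have "B \<ge> 0" using B[OF cell_self[OF x]] norm_ge_zero[of x] by linarith
  then have "t \<ge> 0" unfolding t_def by auto
  have "norm (t *\<^sub>R v) = B + norm x + 1" using \<open>B \<ge> 0\<close> v(1) unfolding t_def by simp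
  moreover have "norm (t *\<^sub>R v) \<le> norm (x + t *\<^sub>R v) + norm x"
    by (metis add_diff_cancel_left' norm_triangle_ineq4)
  ultimately show False using bd[OF \<open>t \<ge> 0\<close>] by linarith
qed

text \<open>If the condition fails, a recession direction can be written down in each case. If it
  holds, comparing each coordinate with the coordinate \<open>jm\<close>, which is 0 on the slice,
  confines the cell to a box.\<close>

lemma bounded_cell_iff:
  assumes x: "x \<in> slice idx"
  shows "bounded (cell x) \<longleftrightarrow> covered x"
proof
  assume bd: "bounded (cell x)"
  show "covered x"
  proof (rule ccontr)
    assume nc: "\<not> covered x"
    show False
    proof (cases "jm \<in> opt i0 x")
      case True
      then obtain n0 where n0: "\<And>i. i \<in> I \<Longrightarrow> n0 \<notin> opt i x" using nc unfolding covered_def by auto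
      have "n0 \<noteq> jm" using True n0 i0 by auto
      \<comment> \<open>Coordinate \<open>n0\<close> is never maximizing, so it can be lowered
        indefinitely.\<close>
      have "\<not> bounded (cell x)"
      proof (rule unbounded_cell[OF x, of "- axis n0 1"])
        show "(- axis n0 1 :: real^'n) $ jm = 0" using \<open>n0 \<noteq> jm\<close> by (simp add: axis_def)
        show "(- axis n0 1 :: real^'n) $ k \<le> (- axis n0 1) $ n" if "i \<in> I" "n \<in> opt i x" for i n k
          using that n0 by (auto simp: axis_def)
      qed (simp add: axis_eq_0_iff)
      then show False using bd by simp
    next
      case False
      obtain n1 where n1: "n1 \<in> opt i0 x" using opt_nonempty[OF i0] by blast
      then have "n1 \<noteq> jm" using False by auto
      show False
      proof (cases "\<exists>i\<in>I. jm \<in> opt i x")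
        case True
        \<comment> \<open>\<open>i1\<close> is the first row in which \<open>jm\<close> is
          maximizing. By noncrossing, the earlier rows have all their maximizing indices below
          \<open>i1\<close>, so all coordinates below \<open>i1\<close> can be raised
          together.\<close>
        define i1 where "i1 = Min {i \<in> I. jm \<in> opt i x}"
        have "i1 \<in> {i \<in> I. jm \<in> opt i x}" unfolding i1_def using True finite_I by (intro Min_in) auto
        then have i1: "i1 \<in> I" "jm \<in> opt i1 x" by auto
        have i1_min: "i1 \<le> i" if "i \<in> I" "jm \<in> opt i x" for i
          unfolding i1_def using that finite_I by (intro Min_le) auto
        have below: "idx n < i1" if "i \<in> I" "n \<in> opt i x" "i < i1" for i n
        proof (rule ccontr)
          assume "\<not> idx n < i1"
          moreover have "n \<noteq> jm" using i1_min[of i] that by auto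
          ultimately show False
            using opt_noncrossing[of i i1 n x jm] that i1 idx_less_jm[of n] by auto
        qed
        have "i0 < i1" using i1 False i0_le_I[of i1] by (cases "i0 = i1") auto
        define v :: "real^'n" where "v = (\<chi> k. if idx k < i1 then 1 else 0)"
        have "\<not> bounded (cell x)"
        proof (rule unbounded_cell[OF x, of v])
          have "v $ n1 = 1" using below[OF i0 n1 \<open>i0 < i1\<close>] unfolding v_def by simp
          then show "v \<noteq> 0" by auto
          show "v $ jm = 0" using I_le_jm[OF i1(1)] unfolding v_def by simp
          show "v $ k \<le> v $ n" if "i \<in> I" "n \<in> opt i x" "i \<le> idx k" for i n k
            using below[OF that(1,2)] that(3) unfolding v_def by auto
        qed
        then show False using bd by simp
      next
        case none: False
        \<comment> \<open>Since \<open>jm\<close> is never maximizing, all other coordinates can be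
          raised together.\<close>
        define v :: "real^'n" where "v = (\<chi> k. if k = jm then 0 else 1)"
        have "\<not> bounded (cell x)"
        proof (rule unbounded_cell[OF x, of v])
          have "v $ n1 = 1" using \<open>n1 \<noteq> jm\<close> unfolding v_def by simp
          then show "v \<noteq> 0" by auto
          show "v $ jm = 0" unfolding v_def by simp
          show "v $ k \<le> v $ n" if "i \<in> I" "n \<in> opt i x" for i n k
            using none that unfolding v_def by auto
        qed
        then show False using bd by simp
      qed
    qed
  qed
next
  assume cov: "covered x"
  then have "\<forall>n. \<exists>i. i \<in> I \<and> n \<in> opt i x" unfolding covered_def by auto
  then obtain \<iota> where \<iota>: "\<And>n. \<iota> n \<in> I" "\<And>n. n \<in> opt (\<iota> n) x" by metis
  \<comment> \<open>Lower bounds come from a row covering \<open>n\<close>, upper bounds from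
    \<open>jm\<close> being maximizing in row \<open>i0\<close>.\<close>
  define a :: "real^'n" where "a = (\<chi> n. h (\<iota> n) (idx n) - h (\<iota> n) (idx jm))"
  define b :: "real^'n" where "b = (\<chi> n. h i0 (idx n) - h i0 (idx jm))"
  have "cell x \<subseteq> cbox a b"
  proof
    fix y assume y: "y \<in> cell x"
    have "a $ n \<le> y $ n \<and> y $ n \<le> b $ n" for n
    proof
      have "n \<in> opt (\<iota> n) y" "jm \<in> opt i0 y" "y $ jm = 0"
        using y \<iota> cov i0 unfolding cell_def covered_def slice_eq by auto
      then show "a $ n \<le> y $ n" "y $ n \<le> b $ n"
        using I_le_jm[OF \<iota>(1)[of n]] i0_le_idx[of n] unfolding opt_def a_def b_def by force+
    qed
    then show "y \<in> cbox a b" by (simp add: mem_box_cart)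
  qed
  then show "bounded (cell x)" using bounded_cbox bounded_subset by blast
qed

lemma Asso_eq: "Asso I idx h = cell ` {x \<in> slice idx. covered x}"
proof -
  have "arrangement_cells I idx h = cell ` slice idx"
    unfolding arrangement_cells_def using closure_constant_opt by (intro image_cong) auto
  then show ?thesis unfolding Asso_def using bounded_cell_iff by auto
qed

lemma covered_mono: "covered x \<Longrightarrow> y \<in> cell x \<Longrightarrow> covered y"
  using i0 unfolding covered_def cell_def by blast

lemma Union_Asso: "\<Union> (Asso I idx h) = {x \<in> slice idx. covered x}"
proof
  show "\<Union> (Asso I idx h) \<subseteq> {x \<in> slice idx. covered x}"
    unfolding Asso_eq using covered_mono cell_subset_slice by blast
  show "{x \<in> slice idx. covered x} \<subseteq> \<Union> (Asso I idx h)"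
    unfolding Asso_eq using cell_self by blast
qed

subsection \<open>Regularity\<close>

lemma finite_Asso: "finite (Asso I idx h)"
proof -
  define F where "F \<phi> = {y \<in> slice idx. \<forall>i\<in>I. \<phi> i \<subseteq> opt i y}" for \<phi> :: "nat \<Rightarrow> 'n set"
  have "cell x = F (restrict (\<lambda>i. opt i x) I)" for x unfolding cell_def F_def by auto
  then have "Asso I idx h \<subseteq> F ` PiE I (\<lambda>_. UNIV)" unfolding Asso_eq by auto
  then show ?thesis by (rule finite_subset) (use finite_I in \<open>simp add: finite_PiE\<close>)
qed

text \<open>Along a segment of \<open>cell x\<close> the optimal values are affine, so what is
  maximizing at an inner point is maximizing at both ends. If the inner point lies in
  \<open>cell y\<close>, then so do the ends.\<close>

lemma cell_Int_face_of: "cell x \<inter> cell y face_of cell x"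
  unfolding face_of_def
proof (intro conjI ballI impI)
  show "convex (cell x \<inter> cell y)"
    using polyhedron_cell by (intro convex_Int polyhedron_imp_convex)
  fix a b w assume ab: "a \<in> cell x" "b \<in> cell x" and w: "w \<in> cell x \<inter> cell y" "w \<in> open_segment a b"
  obtain u where u: "0 < u" "u < 1" "w = (1 - u) *\<^sub>R a + u *\<^sub>R b"
    using w(2) unfolding in_segment by auto
  have "opt i w \<subseteq> opt i a \<inter> opt i b" if i: "i \<in> I" for i
    unfolding u(3)
    using u(1,2) i opt_value_convex_combination[of u i a b] opt_value_concave_on_cell[OF i ab, of u]
    by (intro opt_subset_endpoints) auto
  then show "a \<in> cell x \<inter> cell y" "b \<in> cell x \<inter> cell y"
    using ab w(1) unfolding cell_def by blast+
qed simp

lemma polytopal_complex_Asso: "polytopal_complex (Asso I idx h)"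
  unfolding polytopal_complex_def
proof (intro conjI ballI allI impI)
  fix C assume "C \<in> Asso I idx h"
  then obtain x where x: "x \<in> slice idx" "covered x" and C: "C = cell x" unfolding Asso_eq by auto
  show "polytope C"
    using C bounded_cell_iff[OF x(1)] x(2) polyhedron_cell polytope_eq_bounded_polyhedron by auto
  show "C \<noteq> {}" using C cell_self[OF x(1)] by auto
  fix F assume "F face_of C \<and> F \<noteq> {}"
  then show "F \<in> Asso I idx h"
    unfolding C face_of_cell Asso_eq using covered_mono[OF x(2)] cell_subset_slice by auto
next
  fix C D assume "C \<in> Asso I idx h" "D \<in> Asso I idx h"
  then obtain x y where "C = cell x" "D = cell y" unfolding Asso_eq by auto
  then show "C \<inter> D face_of C" "C \<inter> D face_of D"
    using cell_Int_face_of[of x y] cell_Int_face_of[of y x] by (auto simp: Int_commute)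
qed (rule finite_Asso)

text \<open>The convex piecewise linear function whose domains of linearity are the cells; it serves
  as the lifting function for regularity.\<close>

definition potential :: "real^'n \<Rightarrow> real" where
  "potential x = (\<Sum>i\<in>I. opt_value i x)"

text \<open>Choosing one term of finite height in each row yields an affine function, and the
  potential is the maximum of these finitely many functions.\<close>

definition admissible_choices :: "(nat \<Rightarrow> 'n) set" where
  "admissible_choices = PiE I (\<lambda>i. {n. i \<le> idx n})"

lemma potential_le_iff:
  "potential x \<le> t \<longleftrightarrow> (\<forall>\<sigma>\<in>admissible_choices. (\<Sum>i\<in>I. x $ \<sigma> i - h i (idx (\<sigma> i))) \<le> t)"
proof
  assume "potential x \<le> t"
  moreover have "(\<Sum>i\<in>I. x $ \<sigma> i - h i (idx (\<sigma> i))) \<le> potential x" if "\<sigma> \<in> admissible_choices" for \<sigma>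
    unfolding potential_def using that unfolding admissible_choices_def
    by (intro sum_mono opt_value_ge) auto
  ultimately show "\<forall>\<sigma>\<in>admissible_choices. (\<Sum>i\<in>I. x $ \<sigma> i - h i (idx (\<sigma> i))) \<le> t" by force
next
  assume t: "\<forall>\<sigma>\<in>admissible_choices. (\<Sum>i\<in>I. x $ \<sigma> i - h i (idx (\<sigma> i))) \<le> t"
  have "\<forall>i\<in>I. \<exists>n. i \<le> idx n \<and> x $ n - h i (idx n) = opt_value i x"
    using opt_value_attained by metis
  then obtain \<sigma> where \<sigma>: "\<And>i. i \<in> I \<Longrightarrow> i \<le> idx (\<sigma> i) \<and> x $ \<sigma> i - h i (idx (\<sigma> i)) = opt_value i x"
    by metis
  then have "restrict \<sigma> I \<in> admissible_choices" unfolding admissible_choices_def by auto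
  then have "(\<Sum>i\<in>I. x $ (restrict \<sigma> I) i - h i (idx (restrict \<sigma> I i))) \<le> t" using t by blast
  moreover have "(\<Sum>i\<in>I. x $ (restrict \<sigma> I) i - h i (idx (restrict \<sigma> I i))) = potential x"
    unfolding potential_def using \<sigma> by (intro sum.cong) auto
  ultimately show "potential x \<le> t" by simp
qed

lemma polyhedron_epigraph: "polyhedron {(x, t). potential x \<le> t}"
proof -
  have half: "{(x, t). (\<Sum>i\<in>I. x $ \<sigma> i - h i (idx (\<sigma> i))) \<le> t} =
      {z :: (real^'n) \<times> real. ((\<Sum>i\<in>I. axis (\<sigma> i) 1), - 1) \<bullet> z \<le> (\<Sum>i\<in>I. h i (idx (\<sigma> i)))}" for \<sigma>
    by (auto simp: inner_sum_left inner_axis' sum_subtractf)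
  have "{(x, t). potential x \<le> t} =
      \<Inter> ((\<lambda>\<sigma>. {(x, t). (\<Sum>i\<in>I. x $ \<sigma> i - h i (idx (\<sigma> i))) \<le> t}) ` admissible_choices)"
    by (auto simp: potential_le_iff)
  moreover have "finite admissible_choices"
    unfolding admissible_choices_def using finite_I by (intro finite_PiE) auto
  ultimately show ?thesis
    unfolding half using polyhedron_halfspace_le by (auto intro!: polyhedron_Inter)
qed

lemma potential_bounds:
  assumes "bounded P" "P \<subseteq> slice idx"
  obtains L M where "\<And>x. x \<in> P \<Longrightarrow> L \<le> potential x" "\<And>x. x \<in> P \<Longrightarrow> potential x \<le> M"
proof -
  obtain B where B: "\<And>x. x \<in> P \<Longrightarrow> norm x \<le> B" using assms(1) unfolding bounded_iff by auto
  have "(\<Sum>i\<in>I. - h i (idx jm)) \<le> potential x" if x: "x \<in> P" for x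
    unfolding potential_def
  proof (rule sum_mono)
    fix i assume "i \<in> I"
    then show "- h i (idx jm) \<le> opt_value i x"
      using opt_value_ge[of i jm x] I_le_jm x assms(2) slice_eq by auto
  qed
  moreover have "potential x \<le> (\<Sum>i\<in>I. B + (\<Sum>n\<in>UNIV. \<bar>h i (idx n)\<bar>))" if x: "x \<in> P" for x
    unfolding potential_def
  proof (intro sum_mono opt_value_le)
    fix i n
    have "\<bar>x $ n\<bar> \<le> B" using component_le_norm_cart[of x n] B[OF x] by linarith
    moreover have "\<bar>h i (idx n)\<bar> \<le> (\<Sum>n\<in>UNIV. \<bar>h i (idx n)\<bar>)"
      by (rule member_le_sum) auto
    ultimately show "x $ n - h i (idx n) \<le> B + (\<Sum>n\<in>UNIV. \<bar>h i (idx n)\<bar>)" by linarith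
  qed
  ultimately show ?thesis using that by blast
qed

lemma potential_convex_combination:
  "\<lbrakk>0 \<le> u; u \<le> 1\<rbrakk> \<Longrightarrow>
    potential ((1 - u) *\<^sub>R a + u *\<^sub>R b) \<le> (1 - u) * potential a + u * potential b"
  unfolding potential_def sum_distrib_left sum.distrib[symmetric]
  by (intro sum_mono opt_value_convex_combination)

lemma cell_is_minimizer_set:
  assumes x: "x \<in> slice idx" and P: "cell x \<subseteq> P" "P \<subseteq> slice idx"
  shows "\<exists>c. cell x = {z \<in> P. \<forall>y\<in>P. c \<bullet> z + potential z \<le> c \<bullet> y + potential y}"
proof -
  \<comment> \<open>\<open>- c\<close> averages the slopes of the maximal terms, hence lies in the relative interior of the
    subdifferential of the potential at \<open>x\<close>.\<close>
  define w where "w i = (1 / real (card (opt i x)))" for i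
  define c where "c = - (\<Sum>i\<in>I. w i *\<^sub>R (\<Sum>n\<in>opt i x. axis n 1 :: real^'n))"
  define v where "v i = - (w i * (\<Sum>n\<in>opt i x. h i (idx n)))" for i
  \<comment> \<open>\<open>d i y\<close> is the average amount by which the terms in
    \<open>opt i x\<close> fall short of the maximum at \<open>y\<close>. It is nonnegative and
    vanishes iff all of them are maximizing at \<open>y\<close>. By \<open>split\<close>, minimising
    the tilted potential means minimising the total shortfall, which is zero exactly on the
    cell.\<close>
  define d where "d i y = opt_value i y - w i * (\<Sum>n\<in>opt i x. y $ n - h i (idx n))" for i and y :: "real^'n"
  have split: "c \<bullet> y + potential y = (\<Sum>i\<in>I. d i y) + (\<Sum>i\<in>I. v i)" for y
  proof -
    have "c \<bullet> y = - (\<Sum>i\<in>I. w i * (\<Sum>n\<in>opt i x. y $ n))"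
      unfolding c_def by (simp add: inner_sum_left inner_axis')
    moreover have "opt_value i y - w i * (\<Sum>n\<in>opt i x. y $ n) = d i y + v i" for i
      unfolding d_def v_def by (simp add: sum_subtractf algebra_simps)
    then have "potential y - (\<Sum>i\<in>I. w i * (\<Sum>n\<in>opt i x. y $ n)) = (\<Sum>i\<in>I. d i y + v i)"
      unfolding potential_def sum_subtractf[symmetric] by simp
    ultimately show ?thesis by (simp add: sum.distrib)
  qed
  have card: "card (opt i x) > 0" if "i \<in> I" for i using opt_nonempty[OF that] by (simp add: card_gt_0_iff)
  have d_eq: "d i y = w i * (\<Sum>n\<in>opt i x. opt_value i y - (y $ n - h i (idx n)))" if "i \<in> I" for i y
  proof -
    have "w i * (\<Sum>n\<in>opt i x. opt_value i y) = opt_value i y"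
      using opt_nonempty[OF that] unfolding w_def by simp
    then show ?thesis unfolding d_def by (simp add: sum_subtractf right_diff_distrib)
  qed
  have nonneg: "0 \<le> opt_value i y - (y $ n - h i (idx n))" if "n \<in> opt i x" for i n y
    using that opt_value_ge[of i n y] unfolding opt_def by auto
  have d_nonneg: "0 \<le> d i y" if "i \<in> I" for i y
    unfolding d_eq[OF that] using nonneg
    by (intro mult_nonneg_nonneg sum_nonneg) (auto simp: w_def)
  have d_0: "d i y = 0 \<longleftrightarrow> opt i x \<subseteq> opt i y" if i: "i \<in> I" for i y
  proof -
    have "d i y = 0 \<longleftrightarrow> (\<Sum>n\<in>opt i x. opt_value i y - (y $ n - h i (idx n))) = 0"
      unfolding d_eq[OF i] using card[OF i] by (auto simp: w_def)
    also have "\<dots> \<longleftrightarrow> (\<forall>n\<in>opt i x. opt_value i y - (y $ n - h i (idx n)) = 0)"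
      using nonneg by (intro sum_nonneg_eq_0_iff) auto
    also have "\<dots> \<longleftrightarrow> opt i x \<subseteq> opt i y"
      unfolding opt_iff[OF i, of _ y] subset_iff by (auto simp: opt_def)
    finally show ?thesis .
  qed
  have sum_0: "(\<Sum>i\<in>I. d i y) = 0 \<longleftrightarrow> (\<forall>i\<in>I. opt i x \<subseteq> opt i y)" for y
    using d_nonneg d_0 sum_nonneg_eq_0_iff[OF finite_I, of "\<lambda>i. d i y"] by auto
  have sum_ge: "0 \<le> (\<Sum>i\<in>I. d i y)" for y using d_nonneg by (intro sum_nonneg) auto
  have "cell x = {z \<in> P. \<forall>y\<in>P. (\<Sum>i\<in>I. d i z) \<le> (\<Sum>i\<in>I. d i y)}"
  proof (intro equalityI subsetI)
    fix z assume "z \<in> cell x"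
    then show "z \<in> {z \<in> P. \<forall>y\<in>P. (\<Sum>i\<in>I. d i z) \<le> (\<Sum>i\<in>I. d i y)}"
      using sum_ge sum_0[of z] P unfolding cell_def by auto
  next
    fix z assume z: "z \<in> {z \<in> P. \<forall>y\<in>P. (\<Sum>i\<in>I. d i z) \<le> (\<Sum>i\<in>I. d i y)}"
    then have "(\<Sum>i\<in>I. d i z) \<le> (\<Sum>i\<in>I. d i x)" using cell_self[OF x] P by auto
    then have "(\<Sum>i\<in>I. d i z) = 0" using sum_0[of x] sum_ge[of z] by auto
    then show "z \<in> cell x" using sum_0 z P unfolding cell_def by auto
  qed
  then show ?thesis by (intro exI[of _ c]) (simp add: split)
qed

text \<open>The cell is that of a relatively interior point \<open>x\<close> of \<open>C\<close>.
  Segments through \<open>x\<close> that extend to both sides are used twice: within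
  \<open>C\<close> the potential is affine on them, so maximizing sets can only grow away from
  \<open>x\<close>; within \<open>cell x\<close> the tilted potential is concave on them, so its
  minimum at the inner point \<open>x\<close> forces it to be constant.\<close>

lemma minimizer_set_is_cell:
  assumes C: "C = {z \<in> P. \<forall>y\<in>P. c \<bullet> z + potential z \<le> c \<bullet> y + potential y}"
    and "C \<noteq> {}" "convex P" "P \<subseteq> slice idx" and cells: "\<And>x. x \<in> P \<Longrightarrow> cell x \<subseteq> P"
  shows "\<exists>x\<in>P. C = cell x"
proof -
  define U where "U z = c \<bullet> z + potential z" for z
  have U_conv: "U ((1 - u) *\<^sub>R a + u *\<^sub>R b) \<le> (1 - u) * U a + u * U b" if "0 \<le> u" "u \<le> 1" for u a b
    using potential_convex_combination[OF that, of a b] unfolding U_def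
    by (simp add: algebra_simps inner_add_right)
  have CU: "C = {z \<in> P. \<forall>y\<in>P. U z \<le> U y}" unfolding C U_def ..
  have eqU: "U a = U b" if "a \<in> C" "b \<in> C" for a b
    using that unfolding CU by (auto intro: antisym)
  have "convex C"
    unfolding convex_alt
  proof (intro ballI allI impI)
    fix a b and u :: real assume *: "a \<in> C" "b \<in> C" "0 \<le> u \<and> u \<le> 1"
    have "(1 - u) *\<^sub>R a + u *\<^sub>R b \<in> P"
      using * \<open>convex P\<close> unfolding CU convex_alt by auto
    moreover have "U ((1 - u) *\<^sub>R a + u *\<^sub>R b) \<le> U a"
      using U_conv[of u a b] * eqU[OF *(1,2)] by (simp add: algebra_simps)
    ultimately show "(1 - u) *\<^sub>R a + u *\<^sub>R b \<in> C" using *(1) unfolding CU by force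
  qed
  then obtain x where x: "x \<in> rel_interior C" using \<open>C \<noteq> {}\<close> rel_interior_eq_empty by blast
  then have xC: "x \<in> C" using rel_interior_subset by blast
  then have xP: "x \<in> P" unfolding CU by auto
  have "C \<subseteq> cell x"
  proof
    fix y assume y: "y \<in> C"
    then obtain e where e: "e > 1" "(1 - e) *\<^sub>R y + e *\<^sub>R x \<in> C"
      using x convex_rel_interior_iff[OF \<open>convex C\<close> \<open>C \<noteq> {}\<close>] by blast
    define z where "z = (1 - e) *\<^sub>R y + e *\<^sub>R x"
    define u where "u = 1 / e"
    have u: "0 < u" "u < 1" using e unfolding u_def by auto
    have xyz: "x = (1 - u) *\<^sub>R y + u *\<^sub>R z"
      using e(1) unfolding z_def u_def by (simp add: algebra_simps)
    have le: "opt_value i x \<le> (1 - u) * opt_value i y + u * opt_value i z" if "i \<in> I" for i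
      unfolding xyz using opt_value_convex_combination[of u i y z] u that by auto
    have "U x = (1 - u) * U y + u * U z"
      using eqU[OF y xC] eqU[OF e(2) xC] unfolding z_def[symmetric] by (simp add: algebra_simps)
    moreover have "c \<bullet> x = (1 - u) * (c \<bullet> y) + u * (c \<bullet> z)"
      unfolding xyz by (simp add: inner_add_right)
    ultimately have "potential x = (1 - u) * potential y + u * potential z"
      unfolding U_def by (simp add: algebra_simps)
    \<comment> \<open>Each row contributes a nonnegative convexity gap, so a vanishing total forces
      every gap to vanish.\<close>
    then have "(\<Sum>i\<in>I. (1 - u) * opt_value i y + u * opt_value i z - opt_value i x) = 0"
      unfolding potential_def by (simp add: sum_subtractf sum.distrib sum_distrib_left)
    then have "\<forall>i\<in>I. (1 - u) * opt_value i y + u * opt_value i z - opt_value i x = 0"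
      using le finite_I by (subst (asm) sum_nonneg_eq_0_iff) auto
    then have "opt i x \<subseteq> opt i y" if "i \<in> I" for i
      using opt_subset_endpoints[OF u that, of y z] that xyz by auto
    then show "y \<in> cell x" using y \<open>P \<subseteq> slice idx\<close> unfolding cell_def CU by auto
  qed
  moreover have "cell x \<subseteq> C"
  proof
    fix y assume y: "y \<in> cell x"
    have x_cell: "x \<in> cell x" using xP assms(4) cell_self by auto
    have sub: "tight cell_constraint (cell_indices x) x \<subseteq> tight cell_constraint (cell_indices x) y"
      using tight_cell_subset_iff[OF x_cell y] y unfolding cell_def by auto
    have le: "cell_constraint q x \<le> 0" if "q \<in> cell_indices x" for q
      using x_cell that unfolding cell_eq_constraint_set by auto
    have "\<exists>e>1. \<forall>q\<in>cell_indices x. cell_constraint q ((1 - e) *\<^sub>R y + e *\<^sub>R x) \<le> 0"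
      by (rule prolong_segment[OF finite_cell_indices affine_map_cell_constraint le sub])
    then obtain e where e: "e > 1"
      "\<forall>q\<in>cell_indices x. cell_constraint q ((1 - e) *\<^sub>R y + e *\<^sub>R x) \<le> 0" by auto
    define z where "z = (1 - e) *\<^sub>R y + e *\<^sub>R x"
    have "z \<in> slice idx" unfolding z_def
      using affine_slice x_cell y cell_subset_slice by (intro mem_affine) auto
    then have z: "z \<in> cell x" unfolding cell_eq_constraint_set z_def using e(2) by auto
    define u where "u = 1 / e"
    have u: "0 < u" "u < 1" using e unfolding u_def by auto
    have xyz: "x = (1 - u) *\<^sub>R y + u *\<^sub>R z"
      using e(1) unfolding z_def u_def by (simp add: algebra_simps)
    have "(1 - u) * potential y + u * potential z \<le> potential x"
      unfolding potential_def sum_distrib_left sum.distrib[symmetric] xyz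
      using opt_value_concave_on_cell[OF _ y z] by (intro sum_mono)
    moreover have "c \<bullet> x = (1 - u) * (c \<bullet> y) + u * (c \<bullet> z)"
      unfolding xyz by (simp add: inner_add_right)
    ultimately have "(1 - u) * U y + u * U z \<le> U x"
      unfolding U_def by (simp add: algebra_simps)
    moreover have "y \<in> P" "z \<in> P" using cells[OF xP] y z by auto
    then have "U x \<le> U y" "U x \<le> U z" using xC unfolding CU by auto
    moreover from this have "u * U x \<le> u * U z" using u by auto
    ultimately have "(1 - u) * U y \<le> (1 - u) * U x" by (simp add: algebra_simps)
    then have "U y \<le> U x" using u by auto
    then show "y \<in> C" using xC \<open>y \<in> P\<close> unfolding CU by force
  qed
  ultimately show ?thesis using xP by blast
qed

lemma regular_subdivision_Asso:
  assumes P: "polytope P" and U: "\<Union> (Asso I idx h) = P"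
  shows "regular_subdivision (Asso I idx h) P"
proof -
  have P_slice: "P \<subseteq> slice idx" using U unfolding Union_Asso by auto
  have cells: "cell x \<subseteq> P" if "x \<in> P" for x
    using that U[symmetric] covered_mono cell_subset_slice unfolding Union_Asso by blast
  have AssoP: "Asso I idx h = cell ` P"
    using Asso_eq U Union_Asso by simp
  obtain L M where LM: "\<And>x. x \<in> P \<Longrightarrow> L \<le> potential x" "\<And>x. x \<in> P \<Longrightarrow> potential x \<le> M"
    using potential_bounds[OF polytope_imp_bounded[OF P] P_slice] by blast
  \<comment> \<open>The epigraph of the potential truncated at \<open>M\<close>; together with the
    lower bound \<open>L\<close> it is a product polytope cut by finitely many half-spaces.\<close>
  define Q where "Q = {(x, t). x \<in> P \<and> potential x \<le> t \<and> t \<le> M}"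
  have "(x, t) \<in> Q \<longleftrightarrow> (x, t) \<in> (P \<times> {L..M}) \<inter> {(x, t). potential x \<le> t}" for x t
    unfolding Q_def using LM(1)[of x] by auto
  then have "Q = (P \<times> {L..M}) \<inter> {(x, t). potential x \<le> t}" by (simp add: set_eq_iff)
  moreover have "polytope (P \<times> {L..M})"
    using polytope_Times[OF P polytope_interval[of L M]] by (simp only: cbox_interval)
  ultimately have "polytope Q"
    using polytope_Int_polyhedron[OF _ polyhedron_epigraph] by simp
  moreover have "fst ` Q = P"
  proof
    show "fst ` Q \<subseteq> P" unfolding Q_def by auto
    show "P \<subseteq> fst ` Q"
    proof
      fix x assume "x \<in> P"
      then have "(x, potential x) \<in> Q" unfolding Q_def using LM(2) by simp
      then show "x \<in> fst ` Q" by (metis fst_conv image_eqI)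
    qed
  qed
  moreover have "(\<lambda>F. fst ` F) ` lower_faces Q = Asso I idx h"
  proof -
    have "(\<lambda>F. fst ` F) ` lower_faces Q =
       {C. C \<noteq> {} \<and> (\<exists>c. C = {x \<in> P. \<forall>y\<in>P. c \<bullet> x + potential x \<le> c \<bullet> y + potential y})}"
      by (rule lower_faces_epigraph[OF Q_def LM(2)])
    also have "\<dots> = cell ` P"
    proof (intro equalityI subsetI)
      fix C assume "C \<in> {C. C \<noteq> {} \<and> (\<exists>c. C = {x \<in> P. \<forall>y\<in>P. c \<bullet> x + potential x \<le> c \<bullet> y + potential y})}"
      then obtain c where "C \<noteq> {}" "C = {x \<in> P. \<forall>y\<in>P. c \<bullet> x + potential x \<le> c \<bullet> y + potential y}"
        by auto
      then show "C \<in> cell ` P"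
        using minimizer_set_is_cell[of C P c] polytope_imp_convex[OF P] P_slice cells by auto
    next
      fix C assume "C \<in> cell ` P"
      then obtain x where x: "x \<in> P" "C = cell x" by auto
      then show "C \<in> {C. C \<noteq> {} \<and> (\<exists>c. C = {x \<in> P. \<forall>y\<in>P. c \<bullet> x + potential x \<le> c \<bullet> y + potential y})}"
        using cell_is_minimizer_set[OF _ cells[OF x(1)] P_slice] P_slice cell_self[of x] by auto
    qed
    finally show ?thesis using AssoP by simp
  qed
  ultimately show ?thesis
    using polytopal_complex_Asso P U
    unfolding regular_subdivision_def polyhedral_subdivision_def by blast
qed

subsection \<open>Coordinates relative to the least element\<close>

text \<open>Row \<open>i0\<close> is subtracted from all rows. The Monge inequality survives and now
  says that the difference of two rows increases with the column; in particular each row becomes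
  nondecreasing.\<close>

definition rel_height :: "nat \<Rightarrow> 'n \<Rightarrow> real" where
  "rel_height i n = h i (idx n) - h i0 (idx n)"

text \<open>The matching shift of coordinates keeps the maximizing conditions in the same form; the
  last summand leaves coordinate \<open>jm\<close> unchanged.\<close>

definition rel_coord :: "real^'n \<Rightarrow> 'n \<Rightarrow> real" where
  "rel_coord x n = x $ n - h i0 (idx n) + h i0 (idx jm)"

lemma rel_height_i0 [simp]: "rel_height i0 n = 0"
  unfolding rel_height_def by simp

lemma rel_height_less:
  "\<lbrakk>i \<in> I; i' \<in> I; i < i'; i' \<le> idx n; idx n < idx n'\<rbrakk>
    \<Longrightarrow> rel_height i' n - rel_height i n < rel_height i' n' - rel_height i n'"
  using monge[of i i' n n'] unfolding rel_height_def by auto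

lemma rel_height_le:
  assumes "i \<in> I" "i' \<in> I" "i \<le> i'" "i' \<le> idx n" "idx n \<le> idx n'"
  shows "rel_height i' n - rel_height i n \<le> rel_height i' n' - rel_height i n'"
proof (cases "i = i' \<or> n = n'")
  case False
  then have "i < i'" "idx n < idx n'" using assms inj_idx by (auto simp: order_le_less dest: injD)
  then show ?thesis using rel_height_less[of i i' n n'] assms by auto
qed auto

lemma rel_height_mono:
  "\<lbrakk>i \<in> I; i \<le> idx n; idx n \<le> idx n'\<rbrakk> \<Longrightarrow> rel_height i n \<le> rel_height i n'"
  using rel_height_le[OF i0, of i n n'] i0_le_I by auto

lemma rel_coord_jm: "rel_coord x jm = x $ jm"
  unfolding rel_coord_def by simp

lemma opt_iff_rel: "n \<in> opt i x \<longleftrightarrow>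
    i \<le> idx n \<and> (\<forall>k. i \<le> idx k \<longrightarrow> rel_coord x k - rel_coord x n \<le> rel_height i k - rel_height i n)"
  unfolding opt_def rel_coord_def rel_height_def by (force simp: algebra_simps)

lemma opt_i0_iff: "n \<in> opt i0 x \<longleftrightarrow> (\<forall>k. rel_coord x k \<le> rel_coord x n)"
  unfolding opt_iff_rel using i0_le_idx by auto

text \<open>Row \<open>i0\<close> has relative height zero, so \<open>jm\<close> is maximizing in it
  iff no coordinate exceeds the one at \<open>jm\<close>, which is zero on the slice.\<close>

lemma mem_support_iff: "x \<in> \<Union> (Asso I idx h) \<longleftrightarrow>
    rel_coord x jm = 0 \<and> (\<forall>n. rel_coord x n \<le> 0) \<and> (\<forall>n. \<exists>i\<in>I. n \<in> opt i x)"
  unfolding Union_Asso covered_def slice_eq opt_i0_iff[of jm] rel_coord_jm[symmetric] by auto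

section \<open>Failure of convexity\<close>

definition vec_of_rel :: "('n \<Rightarrow> real) \<Rightarrow> real^'n" where
  "vec_of_rel z = (\<chi> n. z n + h i0 (idx n) - h i0 (idx jm))"

lemma rel_coord_vec_of_rel [simp]: "rel_coord (vec_of_rel z) n = z n"
  unfolding rel_coord_def vec_of_rel_def by simp

lemma support_not_convex:
  assumes a: "a \<in> I" "i0 < a" and n: "a \<le> idx n1" "idx n1 < idx n2" "n2 \<noteq> jm"
    and gap: "\<And>i. \<lbrakk>i \<in> I; i \<le> idx n2\<rbrakk> \<Longrightarrow> i \<le> a"
  shows "\<not> convex (\<Union> (Asso I idx h))"
proof
  assume conv: "convex (\<Union> (Asso I idx h))"
  define b where "b = Max {i \<in> I. i < a}"
  have "b \<in> {i \<in> I. i < a}" unfolding b_def using finite_I i0 a by (intro Max_in) auto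
  then have b: "b \<in> I" "b < a" by auto
  have b_max: "i \<le> b" if "i \<in> I" "i < a" for i
    unfolding b_def using that finite_I by (intro Max_ge) auto
  \<comment> \<open>Writing \<open>b\<close> for the predecessor of \<open>a\<close> in
    \<open>I\<close>, these points are covered by the rows \<open>i0\<close>, \<open>b\<close> and
    \<open>a\<close> alone. The parameter \<open>\<mu>\<close> shifts row \<open>a\<close> against
    row \<open>b\<close>, and the minimum is where the path gets its kink.\<close>
  define z where "z \<mu> k = (if idx k < b then 0 else if idx k < a then rel_height b k - rel_height b jm
      else min (rel_height b k - rel_height b jm) (rel_height a k + \<mu>))" for \<mu> k
  have z_le: "z \<mu> k \<le> rel_height b k - rel_height b jm" if "b \<le> idx k" for \<mu> k
    using that unfolding z_def by auto
  have z_le': "z \<mu> k \<le> rel_height a k + \<mu>" if "a \<le> idx k" for \<mu> k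
    using that b unfolding z_def by auto
  have z_nonpos: "z \<mu> k \<le> 0" for \<mu> k
  proof (cases "idx k < b")
    case False
    then show ?thesis using z_le[of k \<mu>] rel_height_mono[OF b(1), of k jm] idx_le_jm[of k] by auto
  qed (simp add: z_def)
  have supp: "vec_of_rel (z \<mu>) \<in> \<Union> (Asso I idx h)" if \<mu>: "- rel_height a jm \<le> \<mu>" for \<mu>
    unfolding mem_support_iff rel_coord_vec_of_rel
  proof (intro conjI allI)
    show "z \<mu> jm = 0" using \<mu> I_le_jm[OF a(1)] I_le_jm[OF b(1)] unfolding z_def by auto
    show "z \<mu> k \<le> 0" for k by (rule z_nonpos)
    fix k
    consider "z \<mu> k = 0" | "b \<le> idx k" "z \<mu> k = rel_height b k - rel_height b jm"
      | "a \<le> idx k" "z \<mu> k = rel_height a k + \<mu>"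
      unfolding z_def by (smt (verit) linorder_not_le)
    then show "\<exists>i\<in>I. k \<in> opt i (vec_of_rel (z \<mu>))"
    proof cases
      case 1
      then have "k \<in> opt i0 (vec_of_rel (z \<mu>))" using z_nonpos unfolding opt_i0_iff by auto
      then show ?thesis using i0 by blast
    next
      case 2
      have "z \<mu> k' - z \<mu> k \<le> rel_height b k' - rel_height b k" if "b \<le> idx k'" for k'
        using z_le[OF that, of \<mu>] 2 by linarith
      then have "k \<in> opt b (vec_of_rel (z \<mu>))" using 2 unfolding opt_iff_rel by simp
      then show ?thesis using b by blast
    next
      case 3
      have "z \<mu> k' - z \<mu> k \<le> rel_height a k' - rel_height a k" if "a \<le> idx k'" for k'
        using z_le'[OF that, of \<mu>] 3 by linarith
      then have "k \<in> opt a (vec_of_rel (z \<mu>))" using 3 unfolding opt_iff_rel by simp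
      then show ?thesis using a by blast
    qed
  qed
  \<comment> \<open>With this shift the rows \<open>a\<close> and \<open>b\<close> tie at
    \<open>n1\<close>, so by Monge row \<open>b\<close> gives the minimum from \<open>n1\<close>
    onwards. With the shift \<open>- rel_height a jm\<close> they tie at \<open>jm\<close> and row
    \<open>a\<close> gives it instead. The midpoint therefore averages the two rows on these
    columns.\<close>
  define \<mu> where "\<mu> = rel_height b n1 - rel_height b jm - rel_height a n1"
  have "- rel_height a jm \<le> \<mu>"
    using rel_height_le[OF b(1) a(1), of n1 jm] b n idx_le_jm unfolding \<mu>_def by auto
  define w where "w = (1 / 2) *\<^sub>R vec_of_rel (z (- rel_height a jm)) + (1 / 2) *\<^sub>R vec_of_rel (z \<mu>)"
  have "w \<in> \<Union> (Asso I idx h)"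
    using conv supp[of "- rel_height a jm"] supp[OF \<open>- rel_height a jm \<le> \<mu>\<close>]
    unfolding w_def by (intro convexD) auto
  then obtain i where i: "i \<in> I" "n2 \<in> opt i w" unfolding mem_support_iff by blast
  have w_coord: "2 * rel_coord w k =
      rel_height a k - rel_height a jm + (rel_height b k - rel_height b jm)"
    if "idx n1 \<le> idx k" for k
  proof -
    have "z (- rel_height a jm) k = rel_height a k - rel_height a jm"
      using rel_height_le[OF b(1) a(1), of k jm] b n that idx_le_jm unfolding z_def by auto
    moreover have "z \<mu> k = rel_height b k - rel_height b jm"
      using rel_height_le[OF b(1) a(1), of n1 k] b n that unfolding z_def \<mu>_def by auto
    moreover have "2 * rel_coord w k = rel_coord (vec_of_rel (z (- rel_height a jm))) k + rel_coord (vec_of_rel (z \<mu>)) k"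
      unfolding w_def rel_coord_def by (simp add: algebra_simps)
    ultimately show ?thesis unfolding rel_coord_vec_of_rel by linarith
  qed
  have n2: "idx n2 < idx jm" using n idx_less_jm by auto
  have le: "rel_coord w k - rel_coord w n2 \<le> rel_height i k - rel_height i n2" if "i \<le> idx k" for k
    using i(2) that unfolding opt_iff_rel by auto
  have "i \<le> a" using gap[OF i(1)] i(2) unfolding opt_iff_rel by auto
  show False
  \<comment> \<open>No row can cover \<open>n2\<close> at the midpoint: row \<open>a\<close> is
    beaten by column \<open>n1\<close>, and rows up to \<open>b\<close> are beaten by column
    \<open>jm\<close>. Both use strict Monge for the rows \<open>b\<close> and
    \<open>a\<close>.\<close>
  proof (cases "i = a")
    case True
    then show False
      using le[of n1] w_coord[of n1] w_coord[of n2] n rel_height_less[OF b(1) a(1) b(2), of n1 n2] by auto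
  next
    case False
    then have "i \<le> b" using b_max i \<open>i \<le> a\<close> by auto
    then show False
      using le[of jm] w_coord[of jm] w_coord[of n2] n n2 I_le_jm[OF i(1)] b
        rel_height_less[OF b(1) a(1) b(2), of n2 jm] rel_height_le[OF i(1) b(1), of n2 jm] by auto
  qed
qed

end

section \<open>The separated case\<close>

text \<open>\<open>N\<close> indexes the elements of \<open>J'\<close> other than the maximum, and
  \<open>e\<close> lists them increasingly with labels \<open>1\<close> to \<open>m\<close>,
  followed by \<open>jm\<close>. The assumption \<open>separated\<close> is the absence of
  consecutive barred elements.\<close>

locale associahedral_arrangement = monge_arrangement I idx h i0 jm
  for I :: "nat set" and idx :: "'n::finite \<Rightarrow> nat" and h i0 jm +
  fixes N :: "'n set" and m :: nat and e :: "nat \<Rightarrow> 'n"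
  assumes N: "N = {n. n \<noteq> jm \<and> (\<exists>i\<in>I. i0 < i \<and> i \<le> idx n)}"
    and separated: "\<lbrakk>n \<in> N; n' \<in> N; idx n < idx n'\<rbrakk> \<Longrightarrow> \<exists>i\<in>I. idx n < i \<and> i \<le> idx n'"
    and e: "bij_betw e {1..m} N" and e_jm: "e (Suc m) = jm"
    and e_mono: "\<lbrakk>1 \<le> l; l < k; k \<le> Suc m\<rbrakk> \<Longrightarrow> idx (e l) < idx (e k)"
begin

definition pred_I :: "'n \<Rightarrow> nat" where
  "pred_I n = Max {i \<in> I. i \<le> idx n}"

lemma pred_I: "pred_I n \<in> I" "pred_I n \<le> idx n"
proof -
  have "pred_I n \<in> {i \<in> I. i \<le> idx n}"
    unfolding pred_I_def using finite_I i0 i0_le_idx by (intro Max_in) auto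
  then show "pred_I n \<in> I" "pred_I n \<le> idx n" by auto
qed

lemma le_pred_I: "\<lbrakk>i \<in> I; i \<le> idx n\<rbrakk> \<Longrightarrow> i \<le> pred_I n"
  unfolding pred_I_def using finite_I by (intro Max_ge) auto

lemma i0_less_pred_I: "n \<in> N \<Longrightarrow> i0 < pred_I n"
  unfolding N using le_pred_I by (auto intro: less_le_trans)

text \<open>Separation places an element of \<open>I\<close> between the two columns. This makes the
  rows used in \<open>label_bound\<close> distinct, as strict Monge requires.\<close>

lemma pred_I_less: "\<lbrakk>n \<in> N; n' \<in> N; idx n < idx n'\<rbrakk> \<Longrightarrow> pred_I n < pred_I n'"
  using separated[of n n'] pred_I(2)[of n] le_pred_I[of _ n'] by force

lemma jm_notin_N: "jm \<notin> N"
  unfolding N by auto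

lemma e_in_N: "\<lbrakk>1 \<le> l; l \<le> m\<rbrakk> \<Longrightarrow> e l \<in> N"
  using e unfolding bij_betw_def by auto

text \<open>The labels \<open>0\<close> and \<open>Suc m\<close> both stand for the coordinate fixed to \<open>0\<close> on the slice.\<close>

definition label_coord :: "real^'n \<Rightarrow> nat \<Rightarrow> real" where
  "label_coord x l = (if l = 0 then 0 else rel_coord x (e l))"

text \<open>Label \<open>0\<close> uses row \<open>i0\<close>, whose relative heights vanish, so its
  inequalities say that coordinates are nonpositive.\<close>

definition label_bound :: "nat \<Rightarrow> nat \<Rightarrow> real" where
  "label_bound l k = (if l = 0 then 0 else rel_height (pred_I (e l)) (e k) - rel_height (pred_I (e l)) (e l))"

text \<open>The diagonal \<open>(a, b)\<close> of the \<open>(m + 3)\<close>-gon stands for the pair of labels \<open>(a, b - 1)\<close>.\<close>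

definition diagonal_constraint :: "nat \<times> nat \<Rightarrow> real^'n \<Rightarrow> real" where
  "diagonal_constraint = (\<lambda>(a, b) x. label_coord x (b - 1) - label_coord x a - label_bound a (b - 1))"

definition flat :: "(real^'n) set" where
  "flat = {x. \<forall>n. n \<notin> N \<longrightarrow> rel_coord x n = 0}"

definition asso_polytope :: "(real^'n) set" where
  "asso_polytope = {x \<in> flat. \<forall>p\<in>diagonals (m + 3). diagonal_constraint p x \<le> 0}"

lemma label_bound_self: "label_bound s s = 0"
  unfolding label_bound_def by simp

text \<open>The hypotheses force \<open>1 \<le> s' \<le> m\<close>, so \<open>s'\<close> labels an
  element of \<open>N\<close>. The rows belonging to \<open>s\<close> and \<open>s'\<close> are
  strictly ordered, and the columns \<open>k\<close> and \<open>k'\<close> lie above both.\<close>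

lemma label_bound_monge:
  assumes "s < s'" "s' \<le> k" "k < k'" "k' \<le> Suc m"
  shows "label_bound s k' + label_bound s' k < label_bound s k + label_bound s' k'"
proof -
  have s': "e s' \<in> N" using assms by (intro e_in_N) auto
  have kk: "idx (e k) < idx (e k')" using assms by (intro e_mono) auto
  have "pred_I (e s') \<le> idx (e s')" by (rule pred_I)
  also have "\<dots> \<le> idx (e k)" using assms e_mono[of s' k] by (cases "s' = k") auto
  finally have p: "pred_I (e s') \<le> idx (e k)" .
  show ?thesis
  proof (cases "s = 0")
    case True
    then show ?thesis
      using rel_height_less[OF i0 pred_I(1) i0_less_pred_I[OF s'] p kk] assms
      unfolding label_bound_def by auto
  next
    case False
    then have "pred_I (e s) < pred_I (e s')"
      using assms s' by (intro pred_I_less e_in_N e_mono) auto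
    from rel_height_less[OF pred_I(1) pred_I(1) this p kk] show ?thesis
      using False assms unfolding label_bound_def by auto
  qed
qed

lemma diagonals_iff: "(a, b) \<in> diagonals (m + 3) \<longleftrightarrow> a < b - 1 \<and> b - 1 \<le> Suc m \<and> 0 < b \<and> (a, b - 1) \<noteq> (0, Suc m)"
  unfolding diagonals_def by auto

text \<open>The pair \<open>(0, Suc m)\<close> is a side of the polygon and not a diagonal, but its
  inequality reads \<open>0 \<le> 0\<close> on \<open>flat\<close>.\<close>

lemma mem_asso_polytope_iff: "x \<in> asso_polytope \<longleftrightarrow> x \<in> flat \<and>
    (\<forall>l k. l < k \<longrightarrow> k \<le> Suc m \<longrightarrow> label_coord x k - label_coord x l \<le> label_bound l k)"
proof
  assume x: "x \<in> asso_polytope"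
  have "label_coord x k - label_coord x l \<le> label_bound l k" if "l < k" "k \<le> Suc m" for l k
  proof (cases "(l, k) = (0, Suc m)")
    case True
    then show ?thesis using x jm_notin_N e_jm
      unfolding asso_polytope_def flat_def label_coord_def label_bound_def by auto
  next
    case False
    then have "(l, Suc k) \<in> diagonals (m + 3)" using that unfolding diagonals_iff by auto
    then have "diagonal_constraint (l, Suc k) x \<le> 0" using x unfolding asso_polytope_def by blast
    then show ?thesis unfolding diagonal_constraint_def by simp
  qed
  then show "x \<in> flat \<and> (\<forall>l k. l < k \<longrightarrow> k \<le> Suc m \<longrightarrow> label_coord x k - label_coord x l \<le> label_bound l k)"
    using x unfolding asso_polytope_def by auto
next
  assume x: "x \<in> flat \<and> (\<forall>l k. l < k \<longrightarrow> k \<le> Suc m \<longrightarrow> label_coord x k - label_coord x l \<le> label_bound l k)"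
  have "diagonal_constraint p x \<le> 0" if p: "p \<in> diagonals (m + 3)" for p
  proof -
    obtain a b where ab: "p = (a, b)" by (cases p)
    then have "a < b - 1" "b - 1 \<le> Suc m" using p diagonals_iff by auto
    then show ?thesis using x unfolding ab diagonal_constraint_def by auto
  qed
  then show "x \<in> asso_polytope" using x unfolding asso_polytope_def by auto
qed

text \<open>A column outside \<open>N\<close> other than \<open>jm\<close> can only be covered by
  row \<open>i0\<close>. For a column in \<open>N\<close>, covering by any row implies, by Monge,
  the inequalities of its predecessor row towards larger columns; conversely, these inequalities
  make the predecessor row cover it.\<close>

lemma support_eq_asso_polytope: "\<Union> (Asso I idx h) = asso_polytope"
proof (intro equalityI subsetI)
  fix x assume "x \<in> \<Union> (Asso I idx h)"
  then have x: "rel_coord x jm = 0" "\<And>n. rel_coord x n \<le> 0" "\<And>n. \<exists>i\<in>I. n \<in> opt i x"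
    unfolding mem_support_iff by auto
  have "rel_coord x n = 0" if "n \<notin> N" for n
  proof (cases "n = jm")
    case False
    obtain i where i: "i \<in> I" "n \<in> opt i x" using x(3) by blast
    then have "\<not> i0 < i" using that False unfolding N opt_iff_rel by auto
    then have "i = i0" using i0_le_I[OF i(1)] by auto
    then have "rel_coord x jm \<le> rel_coord x n" using i(2) opt_i0_iff[of n x] by simp
    then show ?thesis using x(1) x(2)[of n] by auto
  qed (use x in simp)
  moreover have "label_coord x k - label_coord x l \<le> label_bound l k" if lk: "l < k" "k \<le> Suc m" for l k
  proof (cases "l = 0")
    case True
    then show ?thesis using x(2) unfolding label_coord_def label_bound_def by auto
  next
    case False
    obtain i where i: "i \<in> I" "e l \<in> opt i x" using x(3) by blast
    have less: "idx (e l) < idx (e k)" using lk False by (intro e_mono) auto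
    have "i \<le> idx (e l)" using i(2) unfolding opt_iff_rel by auto
    then have "rel_coord x (e k) - rel_coord x (e l) \<le> rel_height i (e k) - rel_height i (e l)"
      using i(2) less unfolding opt_iff_rel by auto
    moreover have "i \<le> pred_I (e l)" using le_pred_I[OF i(1) \<open>i \<le> idx (e l)\<close>] .
    then have "rel_height (pred_I (e l)) (e l) - rel_height i (e l) \<le> rel_height (pred_I (e l)) (e k) - rel_height i (e k)"
      using less pred_I i(1) by (intro rel_height_le) auto
    ultimately show ?thesis using False lk unfolding label_coord_def label_bound_def by auto
  qed
  ultimately show "x \<in> asso_polytope" unfolding mem_asso_polytope_iff flat_def by auto
next
  fix x assume "x \<in> asso_polytope"
  then have flat: "\<And>n. n \<notin> N \<Longrightarrow> rel_coord x n = 0"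
    and le: "\<And>l k. \<lbrakk>l < k; k \<le> Suc m\<rbrakk> \<Longrightarrow> label_coord x k - label_coord x l \<le> label_bound l k"
    unfolding mem_asso_polytope_iff flat_def by auto
  have N_label: "\<exists>l. 1 \<le> l \<and> l \<le> m \<and> n = e l" if "n \<in> N" for n
    using that e unfolding bij_betw_def by auto
  have nonpos: "rel_coord x n \<le> 0" for n
  proof (cases "n \<in> N")
    case True
    then obtain l where l: "1 \<le> l" "l \<le> m" "n = e l" using N_label by blast
    then show ?thesis using le[of 0 l] unfolding label_coord_def label_bound_def by auto
  qed (simp add: flat)
  have "\<exists>i\<in>I. n \<in> opt i x" for n
  proof (cases "n \<in> N")
    case False
    then have "n \<in> opt i0 x" using flat nonpos unfolding opt_i0_iff by auto
    then show ?thesis using i0 by blast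
  next
    case True
    then obtain l where l: "1 \<le> l" "l \<le> m" "n = e l" using N_label by blast
    have "rel_coord x k - rel_coord x n \<le> rel_height (pred_I n) k - rel_height (pred_I n) n"
      if k: "pred_I n \<le> idx k" for k
    proof -
      have "k \<in> N \<or> k = jm" using k pred_I(1)[of n] i0_less_pred_I[OF True] unfolding N by auto
      then obtain l' where l': "1 \<le> l'" "l' \<le> Suc m" "k = e l'"
        using N_label e_jm by (metis le_SucI le_add1 le_refl plus_1_eq_Suc)
      \<comment> \<open>By separation, a smaller column has a strictly smaller predecessor, whereas
        \<open>k\<close> lies above the predecessor of \<open>n\<close>. Hence the inequalities
        towards larger labels suffice.\<close>
      have "\<not> l' < l"
      proof
        assume "l' < l"
        then have "pred_I k < pred_I n" "idx k < idx n"
          unfolding l(3) l'(3) using l l' by (auto intro!: pred_I_less e_in_N e_mono)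
        moreover have "pred_I n \<le> pred_I k" using le_pred_I[OF pred_I(1) k] .
        ultimately show False by auto
      qed
      then consider "l = l'" | "l < l'" by linarith
      then show ?thesis
      proof cases
        case 1
        then show ?thesis using l l' by simp
      next
        case 2
        then show ?thesis using le[OF 2 l'(2)] l l' unfolding label_coord_def label_bound_def by auto
      qed
    qed
    then have "n \<in> opt (pred_I n) x" using pred_I(2)[of n] unfolding opt_iff_rel by auto
    then show ?thesis using pred_I(1) by blast
  qed
  then show "x \<in> \<Union> (Asso I idx h)"
    unfolding mem_support_iff using nonpos flat jm_notin_N by auto
qed

section \<open>Faces and dimension of the polytope\<close>

lemma affine_map_diagonal_constraint: "affine_map (diagonal_constraint p)"
proof -
  obtain a b where p: "p = (a, b)" by (cases p)
  have "affine_map (\<lambda>x. label_coord x l)" for l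
    unfolding label_coord_def rel_coord_def by (cases "l = 0") (simp_all add: affine_map_intros)
  then show ?thesis unfolding p diagonal_constraint_def by (simp add: affine_map_diff affine_map_const)
qed

lemma finite_diagonals: "finite (diagonals k)"
  by (rule finite_subset[of _ "{..<k} \<times> {..<k}"]) (auto simp: diagonals_def)

lemma affine_flat: "affine flat"
  unfolding affine_def
proof (intro ballI allI impI)
  fix x y :: "real^'n" and u v :: real assume *: "x \<in> flat" "y \<in> flat" "u + v = 1"
  have "rel_coord (u *\<^sub>R x + v *\<^sub>R y) n = u * rel_coord x n + v * rel_coord y n" for n
  proof -
    have "u * c + v * c = c" for c :: real using *(3) by (metis distrib_right mult_1)
    from this[of "h i0 (idx jm) - h i0 (idx n)"] show ?thesis
      unfolding rel_coord_def by (simp add: algebra_simps)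
  qed
  then show "u *\<^sub>R x + v *\<^sub>R y \<in> flat" using * unfolding flat_def by simp
qed

lemma polytope_asso_polytope: "polytope asso_polytope"
proof -
  have "asso_polytope = flat \<inter> \<Inter> ((\<lambda>p. {x. diagonal_constraint p x \<le> 0}) ` diagonals (m + 3))"
    unfolding asso_polytope_def by auto
  then have "polyhedron asso_polytope"
    using affine_imp_polyhedron[OF affine_flat] finite_diagonals affine_map_diagonal_constraint
    by (auto intro!: polyhedron_Int polyhedron_affine_map_le)
  moreover have "bounded asso_polytope"
    unfolding support_eq_asso_polytope[symmetric] using finite_Asso
    by (intro bounded_Union) (auto simp: Asso_def)
  ultimately show ?thesis using polytope_eq_bounded_polyhedron by blast
qed

text \<open>In labels the crossing reads \<open>a < a' \<le> b - 1 < b' - 1\<close>, which is the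
  Monge configuration. Equality \<open>a' = b - 1\<close> may occur, and then the inner bound is
  \<open>label_bound a' a' = 0\<close>.\<close>

lemma tight_noncrossing:
  assumes x: "x \<in> asso_polytope" and "p \<in> tight diagonal_constraint (diagonals (m + 3)) x"
    "q \<in> tight diagonal_constraint (diagonals (m + 3)) x" and lt: "fst p < fst q" "fst q < snd p" "snd p < snd q"
  shows False
proof -
  obtain a b a' b' where pq: "p = (a, b)" "q = (a', b')" by (cases p, cases q)
  have *: "a < b - 1" "b - 1 \<le> Suc m" "a' < b' - 1" "b' - 1 \<le> Suc m"
    "label_coord x (b - 1) - label_coord x a = label_bound a (b - 1)"
    "label_coord x (b' - 1) - label_coord x a' = label_bound a' (b' - 1)"
    using assms(2,3) diagonals_iff unfolding pq tight_def diagonal_constraint_def by auto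
  have lt': "a < a'" "a' \<le> b - 1" "b - 1 < b' - 1" using lt * unfolding pq fst_conv snd_conv by linarith+
  have "label_coord x (b' - 1) - label_coord x a \<le> label_bound a (b' - 1)"
    using x * lt' unfolding mem_asso_polytope_iff by auto
  moreover have "label_coord x (b - 1) - label_coord x a' \<le> label_bound a' (b - 1)"
    using x * lt' label_bound_self[of a'] unfolding mem_asso_polytope_iff by (cases "a' = b - 1") auto
  ultimately show False using label_bound_monge[OF lt' *(4)] *(5,6) by linarith
qed

lemma dissection_realized:
  assumes D: "D \<in> dissections (m + 3)"
  shows "\<exists>x\<in>asso_polytope. tight diagonal_constraint (diagonals (m + 3)) x = D"
proof -
  \<comment> \<open>The polygon side joining the first and last vertices is added as the outer arc;
    its tightness gives the labels \<open>0\<close> and \<open>Suc m\<close> the same value.\<close>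
  define D0 where "D0 = insert (0, Suc m) {(s, k). (s, Suc k) \<in> D}"
  have D_sub: "\<And>s k. (s, k) \<in> D \<Longrightarrow> s < k - 1 \<and> k - 1 \<le> Suc m \<and> 0 < k \<and> (s, k - 1) \<noteq> (0, Suc m)"
    using D diagonals_iff unfolding dissections_def by blast
  have D_nc: "\<And>p q. p \<in> D \<Longrightarrow> q \<in> D \<Longrightarrow> \<not> crossing p q"
    using D unfolding dissections_def by blast
  have mM: "Min {..Suc m} = 0" "Max {..Suc m} = Suc m" by (auto intro: Min_eqI Max_eqI)
  have "\<exists>z. \<forall>s\<in>{..Suc m}. \<forall>k\<in>{..Suc m}. s < k \<longrightarrow>
      z k - z s \<le> label_bound s k \<and> (z k - z s = label_bound s k \<longleftrightarrow> (s, k) \<in> D0)"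
  proof (rule noncrossing_set_is_tight_set)
    show "label_bound s s = 0" for s by (rule label_bound_self)
    show "label_bound s k' + label_bound s' k < label_bound s k + label_bound s' k'"
      if "s < s'" "s' \<le> k" "k < k'" "k' \<in> {..Suc m}" for s s' k k'
      using label_bound_monge that by auto
    show "D0 \<subseteq> {(s, k). s \<in> {..Suc m} \<and> k \<in> {..Suc m} \<and> s < k}"
      unfolding D0_def using D_sub by fastforce
    show "(Min {..Suc m}, Max {..Suc m}) \<in> D0" unfolding mM D0_def by auto
    fix s k s' k' assume *: "(s, k) \<in> D0" "(s', k') \<in> D0" "s < s'" "s' \<le> k" "k < k'"
    have "k' \<le> Suc m" using *(2) D_sub[of s' "Suc k'"] unfolding D0_def by auto
    \<comment> \<open>Neither pair is the added one: \<open>k < k' \<le> Suc m\<close> excludes the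
      first, and \<open>0 \<le> s < s'\<close> the second.\<close>
    then have "(s, Suc k) \<in> D" "(s', Suc k') \<in> D" using * unfolding D0_def by auto
    then show False using D_nc[of "(s, Suc k)" "(s', Suc k')"] * unfolding crossing_def by auto
  qed simp
  then obtain z where z: "\<forall>s\<in>{..Suc m}. \<forall>k\<in>{..Suc m}. s < k \<longrightarrow>
      z k - z s \<le> label_bound s k \<and> (z k - z s = label_bound s k \<longleftrightarrow> (s, k) \<in> D0)" ..
  have zle: "z k - z s \<le> label_bound s k" and zeq: "z k - z s = label_bound s k \<longleftrightarrow> (s, k) \<in> D0"
    if "s < k" "k \<le> Suc m" for s k
    using z that by auto
  have "z (Suc m) - z 0 = label_bound 0 (Suc m)" using zeq[of 0 "Suc m"] unfolding D0_def by auto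
  then have z0: "z (Suc m) = z 0" unfolding label_bound_def by simp
  \<comment> \<open>Subtracting \<open>z 0\<close> gives the labels \<open>0\<close> and
    \<open>Suc m\<close> the value zero, as \<open>flat\<close> requires.\<close>
  define x where "x = vec_of_rel (\<lambda>n. if n \<in> N then z (inv_into {1..m} e n) - z 0 else 0)"
  have coord: "label_coord x l = z l - z 0" if l: "l \<le> Suc m" for l
  proof -
    consider "l = 0" | "l = Suc m" | "1 \<le> l" "l \<le> m" using l by linarith
    then show ?thesis
    proof cases
      case 1
      then show ?thesis unfolding label_coord_def by simp
    next
      case 2
      then show ?thesis using jm_notin_N z0 e_jm unfolding label_coord_def x_def by simp
    next
      case 3
      then have "inv_into {1..m} e (e l) = l"
        using e unfolding bij_betw_def by (intro inv_into_f_f) auto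
      then show ?thesis using 3 e_in_N[of l] unfolding label_coord_def x_def by simp
    qed
  qed
  have "x \<in> asso_polytope"
    unfolding mem_asso_polytope_iff using coord zle by (auto simp: flat_def x_def)
  moreover have "diagonal_constraint (a, b) x = 0 \<longleftrightarrow> (a, b) \<in> D" if ab: "(a, b) \<in> diagonals (m + 3)" for a b
  proof -
    have *: "a < b - 1" "b - 1 \<le> Suc m" "0 < b" "(a, b - 1) \<noteq> (0, Suc m)"
      using ab unfolding diagonals_iff by auto
    have "diagonal_constraint (a, b) x = 0 \<longleftrightarrow> z (b - 1) - z a = label_bound a (b - 1)"
      using * coord unfolding diagonal_constraint_def by auto
    also have "\<dots> \<longleftrightarrow> (a, b - 1) \<in> D0" by (rule zeq[OF *(1,2)])
    also have "\<dots> \<longleftrightarrow> (a, b) \<in> D" using * unfolding D0_def by auto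
    finally show ?thesis .
  qed
  then have "tight diagonal_constraint (diagonals (m + 3)) x = D"
    using D unfolding tight_def dissections_def by auto
  ultimately show ?thesis by blast
qed

lemma tight_image_asso_polytope:
  "tight diagonal_constraint (diagonals (m + 3)) ` asso_polytope = dissections (m + 3)"
proof
  show "dissections (m + 3) \<subseteq> tight diagonal_constraint (diagonals (m + 3)) ` asso_polytope"
    using dissection_realized by blast
  show "tight diagonal_constraint (diagonals (m + 3)) ` asso_polytope \<subseteq> dissections (m + 3)"
  proof
    fix D assume "D \<in> tight diagonal_constraint (diagonals (m + 3)) ` asso_polytope"
    then obtain x where x: "x \<in> asso_polytope" and D: "D = tight diagonal_constraint (diagonals (m + 3)) x"
      by auto
    have "\<not> crossing p q" if "p \<in> D" "q \<in> D" for p q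
      using tight_noncrossing[OF x, of p q] tight_noncrossing[OF x, of q p] that
      unfolding D crossing_def by auto
    moreover have "D \<subseteq> diagonals (m + 3)" unfolding D tight_def by auto
    ultimately show "D \<in> dissections (m + 3)" unfolding dissections_def by auto
  qed
qed

lemma card_N: "card N = m"
  using bij_betw_same_card[OF e] by simp

lemma aff_dim_flat: "aff_dim flat = int m"
proof -
  define V :: "(real^'n) set" where "V = {v. \<forall>n. n \<notin> N \<longrightarrow> v $ n = 0}"
  define o0 where "o0 = vec_of_rel (\<lambda>n. 0)"
  have "flat = (+) o0 ` V"
  proof (intro equalityI subsetI)
    fix x assume "x \<in> flat"
    then have "x - o0 \<in> V" unfolding flat_def V_def o0_def rel_coord_def vec_of_rel_def by auto
    moreover have "x = o0 + (x - o0)" by simp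
    ultimately show "x \<in> (+) o0 ` V" by blast
  next
    fix x assume "x \<in> (+) o0 ` V"
    then show "x \<in> flat" unfolding flat_def V_def o0_def rel_coord_def vec_of_rel_def by auto
  qed
  moreover have "subspace V" unfolding V_def subspace_def by auto
  then have "aff_dim V = int (dim V)" by (rule aff_dim_subspace)
  moreover have "dim V = m"
    using dim_substandard_cart[where 'a = real and d = N] card_N unfolding V_def dim_vec_eq by simp
  ultimately show ?thesis by (simp add: aff_dim_translation_eq)
qed

lemma aff_dim_asso_polytope: "aff_dim asso_polytope = int m"
proof -
  \<comment> \<open>The empty dissection yields a point of \<open>flat\<close> with every constraint
    strict, hence a relatively open piece of \<open>flat\<close> inside the polytope.\<close>
  have "{} \<in> dissections (m + 3)" unfolding dissections_def by simp
  then obtain x where x: "x \<in> asso_polytope" "tight diagonal_constraint (diagonals (m + 3)) x = {}"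
    using dissection_realized by blast
  define U where "U = (\<Inter>p\<in>diagonals (m + 3). {x. diagonal_constraint p x < 0})"
  have "open U" unfolding U_def using finite_diagonals affine_map_diagonal_constraint
    by (intro open_INT ballI open_affine_map_less) auto
  have "x \<in> flat \<inter> U"
    using x unfolding asso_polytope_def U_def tight_def by (auto simp: order_less_le)
  then have "affine hull (flat \<inter> U) = affine hull flat"
    using affine_flat \<open>open U\<close> by (intro affine_hull_affine_Int_open) auto
  then have "aff_dim (flat \<inter> U) = int m" using aff_dim_flat by (metis aff_dim_affine_hull)
  moreover have "flat \<inter> U \<subseteq> asso_polytope" unfolding asso_polytope_def U_def by (auto intro: less_imp_le)
  then have "aff_dim (flat \<inter> U) \<le> aff_dim asso_polytope" by (rule aff_dim_subset)
  moreover have "aff_dim asso_polytope \<le> aff_dim flat"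
    by (rule aff_dim_subset) (auto simp: asso_polytope_def)
  ultimately show ?thesis using aff_dim_flat by auto
qed

lemma combinatorial_associahedron_asso_polytope: "combinatorial_associahedron m asso_polytope"
  unfolding combinatorial_associahedron_def tight_image_asso_polytope[symmetric]
  using polytope_asso_polytope aff_dim_asso_polytope
    face_lattice_of_constraint_set[OF affine_flat finite_diagonals affine_map_diagonal_constraint
      asso_polytope_def]
  by blast

lemma support_is_associahedron:
  "combinatorial_associahedron m (\<Union> (Asso I idx h))"
  "regular_subdivision (Asso I idx h) (\<Union> (Asso I idx h))"
  using combinatorial_associahedron_asso_polytope regular_subdivision_Asso[OF polytope_asso_polytope]
  by (simp_all add: support_eq_asso_polytope)

end

section \<open>Enumeration of the columns and proof of the theorem\<close>

lemma (in monge_arrangement) ex_associahedral_arrangement: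
  assumes N: "N = {n. n \<noteq> jm \<and> (\<exists>i\<in>I. i0 < i \<and> i \<le> idx n)}"
    and sep: "\<And>n n'. \<lbrakk>n \<in> N; n' \<in> N; idx n < idx n'\<rbrakk> \<Longrightarrow> \<exists>i\<in>I. idx n < i \<and> i \<le> idx n'"
  shows "\<exists>e. associahedral_arrangement I idx h i0 jm N (card N) e"
proof -
  have card: "card (idx ` N) = card N" using inj_idx by (intro card_image) (auto intro: inj_on_subset)
  obtain g where g: "bij_betw g {..<card N} (idx ` N)" "strict_mono_on {..<card N} g"
    using ex_bij_betw_strict_mono_card[of "idx ` N"] unfolding card by auto
  \<comment> \<open>\<open>g\<close> counts from 0 while the labels start at 1; hence the
    shift.\<close>
  define e where "e l = (if l = Suc (card N) then jm else inv idx (g (l - 1)))" for l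
  have idx_e: "idx (e l) = g (l - 1)" and e_N: "e l \<in> N" if "1 \<le> l" "l \<le> card N" for l
  proof -
    have "l - 1 \<in> {..<card N}" using that by auto
    then have "g (l - 1) \<in> idx ` N" using g(1) unfolding bij_betw_def by blast
    then show "idx (e l) = g (l - 1)" "e l \<in> N"
      using that inj_idx unfolding e_def by auto
  qed
  have mono: "idx (e l) < idx (e k)" if "1 \<le> l" "l < k" "k \<le> Suc (card N)" for l k
  proof (cases "k = Suc (card N)")
    case True
    then have "e l \<in> N" using that e_N by auto
    then have "e l \<noteq> jm" unfolding N by auto
    then show ?thesis using idx_less_jm True unfolding e_def by auto
  next
    case False
    then have "g (l - 1) < g (k - 1)" using that by (intro strict_mono_onD[OF g(2)]) auto
    then show ?thesis using False that idx_e by auto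
  qed
  have inj: "inj_on e {1..card N}"
    by (rule inj_onI, rule ccontr) (metis atLeastAtMost_iff le_SucI less_irrefl linorder_neqE_nat mono)
  have "e ` {1..card N} = N"
  proof (rule card_subset_eq)
    show "e ` {1..card N} \<subseteq> N" using e_N by auto
    show "card (e ` {1..card N}) = card N" using card_image[OF inj] by simp
  qed simp
  then have "bij_betw e {1..card N} N" using inj unfolding bij_betw_def by auto
  moreover have "e (Suc (card N)) = jm" unfolding e_def by simp
  ultimately have "associahedral_arrangement I idx h i0 jm N (card N) e"
    using mono N sep by unfold_locales auto
  then show ?thesis by blast
qed

theorem theorem5p12:
  fixes I J :: "nat set" and idx :: "'n::finite \<Rightarrow> nat" and h :: "nat \<Rightarrow> nat \<Rightarrow> real"
  assumes "finite I" "I \<noteq> {}" "finite J" "J \<noteq> {}"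
    and "bij_betw idx UNIV J"
    and "\<exists>i\<in>I. \<forall>z\<in>I <+> J. Inl i \<preceq> z"
    and "\<exists>j\<in>J. \<forall>z\<in>I <+> J. z \<preceq> Inr j"
    and "\<And>i i' j j'. \<lbrakk>i \<in> I; i' \<in> I; j \<in> J; j' \<in> J; i < i'; i' \<le> j; j < j'\<rbrakk>
           \<Longrightarrow> h i j' + h i' j < h i j + h i' j'"
  shows "(convex (\<Union>(Asso I idx h)) \<longleftrightarrow>
            \<not> (\<exists>j\<in>J. \<exists>j'\<in>J. consecutive_in ((I <+> J_prime I J) - {Inr (Max J)}) (Inr j) (Inr j')))
       \<and> (convex (\<Union>(Asso I idx h)) \<longrightarrow>
            (\<exists>P. combinatorial_associahedron (card (J_prime I J) - 1) P \<and>
                 regular_subdivision (Asso I idx h) P))"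
proof -
  have J: "J = range idx" and inj: "inj idx" using assms(5) unfolding bij_betw_def by auto
  obtain i0 where i0: "i0 \<in> I" "\<And>z. z \<in> I <+> J \<Longrightarrow> Inl i0 \<preceq> z" using assms(6) by auto
  obtain j0 where j0: "j0 \<in> J" "\<And>z. z \<in> I <+> J \<Longrightarrow> z \<preceq> Inr j0" using assms(7) by auto
  obtain jm where jm: "j0 = idx jm" using j0(1) J by auto
  interpret monge_arrangement I idx h i0 jm
  proof
    show "i0 \<le> i" if "i \<in> I" for i using i0(2)[OF InlI[OF that]] by (auto simp: preceq_def)
    show "i0 \<le> idx n" for n using i0(2)[of "Inr (idx n)"] J by (auto simp: preceq_def InrI)
    show "idx n \<le> idx jm" for n using j0(2)[of "Inr (idx n)"] J jm by (auto simp: preceq_def InrI)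
    show "i \<le> idx jm" if "i \<in> I" for i using j0(2)[OF InlI[OF that]] jm by (auto simp: preceq_def)
  qed (use assms(1,8) inj i0(1) J in auto)
  define N where "N = {n. n \<noteq> jm \<and> (\<exists>i\<in>I. i0 < i \<and> i \<le> idx n)}"
  have Max_J: "Max J = idx jm" using idx_le_jm J by (intro Max_eqI) auto
  have J_prime: "J_prime I J = {idx n | n. \<exists>i\<in>I. i0 < i \<and> i \<le> idx n}"
    unfolding J_prime_def J using i0(1) i0_le_I by (auto intro: le_less_trans)
  have J_prime_N: "J_prime I J - {Max J} = idx ` N"
    unfolding J_prime Max_J N_def using inj by (auto dest: injD)
  have card: "card (J_prime I J) - 1 = card N"
  proof -
    have "card (idx ` N) = card N" using inj by (intro card_image) (auto intro: inj_on_subset)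
    moreover have "card (J_prime I J - {Max J}) = card (J_prime I J) - 1"
    proof (cases "Max J \<in> J_prime I J")
      case False
      \<comment> \<open>Every element of \<open>I\<close> lies below \<open>jm\<close>, so the
        maximum is missing from \<open>J'\<close> only if \<open>I\<close> is a singleton. Then
        \<open>J'\<close> is empty and truncated subtraction gives dimension 0.\<close>
      then have "\<not> (\<exists>i\<in>I. i0 < i)" unfolding J_prime Max_J using I_le_jm by auto
      then have "J_prime I J = {}" unfolding J_prime by auto
      then show ?thesis by simp
    qed (rule card_Diff_singleton)
    ultimately show ?thesis using J_prime_N by simp
  qed
  define S where "S = (I <+> J_prime I J) - {Inr (Max J)}"
  have S: "Inl i \<in> S \<longleftrightarrow> i \<in> I" "Inr j \<in> S \<longleftrightarrow> j \<in> idx ` N" for i j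
    unfolding S_def J_prime_N[symmetric] by auto
  show ?thesis
  proof (cases "\<exists>j\<in>J. \<exists>j'\<in>J. consecutive_in S (Inr j) (Inr j')")
    case True
    then obtain j j' where cons: "consecutive_in S (Inr j) (Inr j')" by blast
    then have "j \<in> idx ` N" "j' \<in> idx ` N" unfolding consecutive_in_def S by auto
    then obtain n1 n2 where n: "n1 \<in> N" "n2 \<in> N" "j = idx n1" "j' = idx n2" by auto
    have lt: "idx n1 < idx n2" using cons n unfolding consecutive_in_def by auto
    have gap: "i \<le> idx n1" if "i \<in> I" "i \<le> idx n2" for i
    proof (rule ccontr)
      assume "\<not> i \<le> idx n1"
      then have "Inl i \<in> S" "prec (Inr j) (Inl i)" "prec (Inl i) (Inr j')" using that n by (auto simp: S)
      then show False using cons unfolding consecutive_in_def by blast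
    qed
    \<comment> \<open>No element of \<open>I\<close> lies between the two columns, so
      \<open>a\<close> is the predecessor of both.\<close>
    define a where "a = Max {i \<in> I. i \<le> idx n1}"
    have "a \<in> {i \<in> I. i \<le> idx n1}" unfolding a_def using finite_I i0(1) i0_le_idx by (intro Max_in) auto
    then have a: "a \<in> I" "a \<le> idx n1" by auto
    have a_max: "i \<le> a" if "i \<in> I" "i \<le> idx n1" for i
      unfolding a_def using that finite_I by (intro Max_ge) auto
    have "i0 < a" using n(1) a_max unfolding N_def by (auto intro: less_le_trans)
    then have "\<not> convex (\<Union> (Asso I idx h))"
      using support_not_convex[OF a(1) _ a(2) lt] n(2) a_max gap unfolding N_def by auto
    then show ?thesis using True unfolding S_def by blast
  next
    case False
    have sep: "\<exists>i\<in>I. idx n < i \<and> i \<le> idx n'" if n: "n \<in> N" "n' \<in> N" "idx n < idx n'" for n n'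
    proof -
      \<comment> \<open>The largest barred element of \<open>S\<close> before \<open>idx n'\<close>
        is not consecutive to it, so some element lies between; a barred one would contradict
        maximality, so it comes from \<open>I\<close>.\<close>
      define B where "B = {j \<in> idx ` N. j < idx n'}"
      have B: "finite B" "idx n \<in> B" using n unfolding B_def by auto
      then have mB: "Max B \<in> B" by (intro Max_in) auto
      then have "\<not> consecutive_in S (Inr (Max B)) (Inr (idx n'))"
        using False J unfolding B_def by auto
      then obtain c where c: "c \<in> S" "prec (Inr (Max B)) c" "prec c (Inr (idx n'))"
        using mB n unfolding consecutive_in_def B_def S by auto
      show ?thesis
      proof (cases c)
        case (Inl i)
        then show ?thesis using c S Max_ge[OF B] by (auto intro: le_less_trans)
      next
        case (Inr j)
        then have "j \<in> B" using c S unfolding B_def by auto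
        then show ?thesis using c Inr Max_ge[OF B(1)] by force
      qed
    qed
    obtain e where e: "associahedral_arrangement I idx h i0 jm N (card N) e"
      using ex_associahedral_arrangement[OF N_def sep] by (rule exE)
    note asso = associahedral_arrangement.support_is_associahedron[OF e]
    \<comment> \<open>The support itself is the associahedron, hence convex, and it is the witness
      for \<open>P\<close>.\<close>
    then have "convex (\<Union> (Asso I idx h))"
      unfolding combinatorial_associahedron_def by (simp add: polytope_imp_convex)
    then show ?thesis using False asso unfolding S_def card by blast
  qed
qed

end
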